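(* Let $k\ge1$ and let $\Omega\subset\subset\mathbb{C}^n$ be a convex domain with $C^k$-smooth boundary. Then $DF(\Omega)=1$ and $S(\Omega)=1$.
   Context: A (global) defining function of $\Omega$ is a $C^k$-smooth real function $\rho$ on a neighborhood $V$ of $\overline\Omega$ with $\Omega=\{z\in V:\rho(z)<0\}$ and $d\rho\neq0$ on $\partial\Omega$. Diederich-Fornæss index: $\eta_\rho:=\sup\{\eta\in(0,1): -(-\rho)^\eta \text{ is strictly plurisubharmonic on }\Omega\}$ (and $\eta_\rho=0$ if there is no such $\eta$); $DF(\Omega):=\sup_\rho\eta_\rho$ over all defining functions $\rho$ of $\Omega$. Steinness index: with $\overline\Omega^{\complement}=\mathbb{C}^n\setminus\overline\Omega$, $\widetilde\eta_\rho:=\inf\{\widetilde\eta>1: \rho^{\widetilde\eta}\text{ is strictly plurisubharmonic on }\overline\Omega^{\complement}\cap U\text{ for some neighborhood }U\text{ of }\partial\Omega\}$ (and $\widetilde\eta_\rho=\infty$ if there is no such $\widetilde\eta$); $S(\Omega):=\inf_\rho\widetilde\eta_\rho$ over all defining functions $\rho$ of $\Omega$. For functions that are not $C^2$, a function $u$ is strictly plurisubharmonic on an open set if near each point there is $c>0$ such that $u-c\|z\|^2$ is plurisubharmonic. *)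

theory Defs
  imports "HOL-Analysis.Analysis"
begin

text \<open>Class $C^k$ on an open set: all iterated directional derivatives up to order k exist and are
  continuous.  The recursion asks for Frechet differentiability at each stage.\<close>

fun higher_differentiable_on ::
    "'a::real_normed_vector set \<Rightarrow> ('a \<Rightarrow> real) \<Rightarrow> nat \<Rightarrow> bool" where
  "higher_differentiable_on S f 0 \<longleftrightarrow> continuous_on S f"
| "higher_differentiable_on S f (Suc k) \<longleftrightarrow>
     (\<forall>x\<in>S. f differentiable (at x)) \<and>
     (\<forall>v. higher_differentiable_on S (\<lambda>x. frechet_derivative f (at x) v) k)"

definition Ck_boundary :: "nat \<Rightarrow> (complex^'n) set \<Rightarrow> bool" where
  "Ck_boundary k \<Omega> \<longleftrightarrow>
     (\<forall>p\<in>frontier \<Omega>. \<exists>U r.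
        open U \<and> p \<in> U \<and> higher_differentiable_on U r k \<and>
        \<Omega> \<inter> U = {z\<in>U. r z < 0} \<and>
        (\<forall>z\<in>U \<inter> frontier \<Omega>. frechet_derivative r (at z) \<noteq> (\<lambda>_. 0)))"

definition upper_semicontinuous_on :: "'a::topological_space set \<Rightarrow> ('a \<Rightarrow> real) \<Rightarrow> bool" where
  "upper_semicontinuous_on S u \<longleftrightarrow>
     (\<forall>x\<in>S. \<forall>a. u x < a \<longrightarrow> eventually (\<lambda>y. u y < a) (at x within S))"

text \<open>Every function considered here is finite-valued, so the value $-\infty$ is not modelled.  For a
  finite-valued upper semicontinuous function the sub-mean value inequality forces integrability
  over circles; it is stated explicitly because the integral of a non-integrable function
  is 0 by convention.\<close>

definition subharmonic_on :: "complex set \<Rightarrow> (complex \<Rightarrow> real) \<Rightarrow> bool" where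
  "subharmonic_on D v \<longleftrightarrow>
     upper_semicontinuous_on D v \<and>
     (\<forall>a r. 0 < r \<and> cball a r \<subseteq> D \<longrightarrow>
        (\<lambda>t. v (a + of_real r * cis t)) integrable_on {0..2*pi} \<and>
        v a \<le> 1 / (2*pi) * integral {0..2*pi} (\<lambda>t. v (a + of_real r * cis t)))"

definition plurisubharmonic_on :: "(complex^'n) set \<Rightarrow> (complex^'n \<Rightarrow> real) \<Rightarrow> bool" where
  "plurisubharmonic_on S u \<longleftrightarrow>
     upper_semicontinuous_on S u \<and>
     (\<forall>z w. subharmonic_on {\<zeta>. z + \<zeta> *s w \<in> S} (\<lambda>\<zeta>. u (z + \<zeta> *s w)))"

definition strictly_plurisubharmonic_on :: "(complex^'n) set \<Rightarrow> (complex^'n \<Rightarrow> real) \<Rightarrow> bool" where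
  "strictly_plurisubharmonic_on S u \<longleftrightarrow>
     (\<forall>p\<in>S. \<exists>W c. open W \<and> p \<in> W \<and> W \<subseteq> S \<and> 0 < c \<and>
        plurisubharmonic_on W (\<lambda>z. u z - c * (norm z)\<^sup>2))"

text \<open>A defining function is the pair of a neighbourhood V of the closure and a total function of
  which only the values on V matter.\<close>

definition defining_function ::
    "nat \<Rightarrow> (complex^'n) set \<Rightarrow> (complex^'n) set \<Rightarrow> (complex^'n \<Rightarrow> real) \<Rightarrow> bool" where
  "defining_function k \<Omega> V \<rho> \<longleftrightarrow>
     open V \<and> closure \<Omega> \<subseteq> V \<and> higher_differentiable_on V \<rho> k \<and>
     \<Omega> = {z\<in>V. \<rho> z < 0} \<and>
     (\<forall>z\<in>frontier \<Omega>. frechet_derivative \<rho> (at z) \<noteq> (\<lambda>_. 0))"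

definition DF_exponents :: "(complex^'n) set \<Rightarrow> (complex^'n \<Rightarrow> real) \<Rightarrow> real set" where
  "DF_exponents \<Omega> \<rho> =
     {\<eta>. 0 < \<eta> \<and> \<eta> < 1 \<and> strictly_plurisubharmonic_on \<Omega> (\<lambda>z. - ((- \<rho> z) powr \<eta>))}"

definition DF_index_of :: "(complex^'n) set \<Rightarrow> (complex^'n \<Rightarrow> real) \<Rightarrow> ereal" where
  "DF_index_of \<Omega> \<rho> =
     (if DF_exponents \<Omega> \<rho> = {} then 0 else Sup (ereal ` DF_exponents \<Omega> \<rho>))"

definition DF_index :: "nat \<Rightarrow> (complex^'n) set \<Rightarrow> ereal" where
  "DF_index k \<Omega> = Sup {DF_index_of \<Omega> \<rho> |V \<rho>. defining_function k \<Omega> V \<rho>}"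

definition Stein_exponents ::
    "(complex^'n) set \<Rightarrow> (complex^'n) set \<Rightarrow> (complex^'n \<Rightarrow> real) \<Rightarrow> real set" where
  "Stein_exponents \<Omega> V \<rho> =
     {\<eta>. 1 < \<eta> \<and> (\<exists>U. open U \<and> frontier \<Omega> \<subseteq> U \<and> U \<subseteq> V \<and>
        strictly_plurisubharmonic_on ((- closure \<Omega>) \<inter> U) (\<lambda>z. \<rho> z powr \<eta>))}"

definition Steinness_index_of ::
    "(complex^'n) set \<Rightarrow> (complex^'n) set \<Rightarrow> (complex^'n \<Rightarrow> real) \<Rightarrow> ereal" where
  "Steinness_index_of \<Omega> V \<rho> =
     (if Stein_exponents \<Omega> V \<rho> = {} then \<infinity> else Inf (ereal ` Stein_exponents \<Omega> V \<rho>))"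

definition Steinness_index :: "nat \<Rightarrow> (complex^'n) set \<Rightarrow> ereal" where
  "Steinness_index k \<Omega> = Inf {Steinness_index_of \<Omega> V \<rho> |V \<rho>. defining_function k \<Omega> V \<rho>}"

end

theory Submission
  imports Defs
begin

text \<open>
  The gauge of a convex domain is as smooth as its boundary away from the centre, so it yields a
  globally convex defining function \<open>f\<close> of class \<open>C^k\<close>.  The boundary may contain segments, so in
  general no defining function is strictly convex.  However, \<open>x^\<eta> y^(1 - \<eta>)\<close> is concave for
  \<open>\<eta> < 1\<close> and convex for \<open>\<eta> > 1\<close>, and strictly monotone in \<open>y\<close>.  Inserting the strictly concave
  \<open>g = R\<^sup>2 - |z|\<^sup>2\<close> for \<open>y\<close> and \<open>|f|\<close> for \<open>x\<close> shows that for \<open>\<rho> = f g^((1 - \<eta>)/\<eta>)\<close> the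
  functions \<open>-(-\<rho>)^\<eta>\<close> inside (\<open>\<eta> < 1\<close>) and \<open>\<rho>^\<eta>\<close> outside (\<open>\<eta> > 1\<close>) are locally strictly
  convex, hence strictly plurisubharmonic.  Every exponent is therefore attained by some defining
  function.
\<close>

section \<open>Calculus of functions of class $C^k$\<close>

text \<open>A derivative at a point depends on values in a whole neighbourhood; openness of
  \<open>S\<close> makes agreement on \<open>S\<close> sufficient at every order.\<close>

lemma higher_differentiable_on_cong:
  assumes "open S" "higher_differentiable_on S f k" "\<And>x. x \<in> S \<Longrightarrow> f x = g x"
  shows "higher_differentiable_on S g k"
  using assms(2,3)
proof (induction k arbitrary: f g)
  case 0
  then show ?case by (simp cong: continuous_on_cong)
next
  case (Suc k)
  have der: "(g has_derivative frechet_derivative f (at x)) (at x)" if "x \<in> S" for x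
  proof (rule has_derivative_transform_within_open[OF _ assms(1) that])
    show "(f has_derivative frechet_derivative f (at x)) (at x)"
      using Suc.prems that by (simp add: frechet_derivative_works[symmetric])
  qed (use Suc.prems in simp)
  have "higher_differentiable_on S (\<lambda>x. frechet_derivative g (at x) v) k" for v
    by (rule Suc.IH[of "\<lambda>x. frechet_derivative f (at x) v"])
      (use Suc.prems frechet_derivative_at[OF der] in simp_all)
  with der show ?case
    by (auto simp: differentiable_def)
qed

text \<open>Derivatives are unique, so an explicit formula \<open>f'\<close> may stand in for the
  chosen \<open>frechet_derivative\<close>. The closure properties below that raise the order go
  through this rule.\<close>

lemma higher_differentiable_on_derivI:
  assumes "open S"
    and "\<And>x. x \<in> S \<Longrightarrow> (f has_derivative f' x) (at x)"
    and "\<And>v. higher_differentiable_on S (\<lambda>x. f' x v) k"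
  shows "higher_differentiable_on S f (Suc k)"
proof -
  have "higher_differentiable_on S (\<lambda>x. frechet_derivative f (at x) v) k" for v
    by (rule higher_differentiable_on_cong[OF assms(1) assms(3)[of v]])
      (simp add: frechet_derivative_at[OF assms(2), symmetric])
  then show ?thesis
    using assms(2) by (auto simp: differentiable_def)
qed

lemma higher_differentiable_on_has_derivative:
  assumes "higher_differentiable_on S f (Suc k)" "x \<in> S"
  shows "(f has_derivative frechet_derivative f (at x)) (at x)"
  using assms frechet_derivative_works by auto

lemma higher_differentiable_on_subset:
  assumes "higher_differentiable_on S f k" "T \<subseteq> S"
  shows "higher_differentiable_on T f k"
  using assms(1)
proof (induction k arbitrary: f)
  case 0
  then show ?case using assms(2) continuous_on_subset by auto
next
  case (Suc k)
  then show ?case using assms(2) by auto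
qed

lemma higher_differentiable_on_Suc_imp:
  "higher_differentiable_on S f (Suc k) \<Longrightarrow> higher_differentiable_on S f k"
proof (induction k arbitrary: f)
  case 0
  then show ?case
    by (auto intro!: differentiable_imp_continuous_on differentiable_at_imp_differentiable_on)
next
  case (Suc k)
  then show ?case by (metis higher_differentiable_on.simps(2))
qed

lemma higher_differentiable_on_le:
  assumes "higher_differentiable_on S f k" "j \<le> k"
  shows "higher_differentiable_on S f j"
  using assms(2,1) by (induction rule: dec_induct) (blast dest: higher_differentiable_on_Suc_imp)+

lemma higher_differentiable_on_imp_continuous_on:
  "higher_differentiable_on S f k \<Longrightarrow> continuous_on S f"
  using higher_differentiable_on_le[of S f k 0] by simp

lemma higher_differentiable_on_local:
  assumes "\<And>x. x \<in> S \<Longrightarrow> \<exists>T. open T \<and> x \<in> T \<and> higher_differentiable_on T f k"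
  shows "higher_differentiable_on S f k"
  using assms
proof (induction k arbitrary: f)
  case 0
  then show ?case
    by (auto intro!: continuous_at_imp_continuous_on) (metis continuous_on_interior interior_open)
next
  case (Suc k)
  have "f differentiable at x" if "x \<in> S" for x
    using Suc.prems[OF that] by auto
  moreover have "higher_differentiable_on S (\<lambda>x. frechet_derivative f (at x) v) k" for v
    by (rule Suc.IH) (metis Suc.prems higher_differentiable_on.simps(2))
  ultimately show ?case by simp
qed

lemma higher_differentiable_on_const [simp]: "higher_differentiable_on S (\<lambda>x. c) k"
  by (induction k arbitrary: c) (auto simp: frechet_derivative_const)

lemma higher_differentiable_on_bounded_linear:
  assumes "open S" "bounded_linear f"
  shows "higher_differentiable_on S f k"
proof (cases k)
  case 0
  then show ?thesis using assms(2) by (simp add: linear_continuous_on)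
next
  case (Suc j)
  show ?thesis
    unfolding Suc
    by (rule higher_differentiable_on_derivI[OF assms(1) bounded_linear_imp_has_derivative[OF assms(2)]]) simp
qed

lemma higher_differentiable_on_add:
  assumes "open S" "higher_differentiable_on S f k" "higher_differentiable_on S g k"
  shows "higher_differentiable_on S (\<lambda>x. f x + g x) k"
  using assms(2,3)
proof (induction k arbitrary: f g)
  case 0
  then show ?case by (simp add: continuous_on_add)
next
  case (Suc k)
  show ?case
    by (rule higher_differentiable_on_derivI[OF assms(1) has_derivative_add])
      (use Suc in \<open>auto intro: higher_differentiable_on_has_derivative\<close>)
qed

lemma higher_differentiable_on_mult:
  assumes "open S" "higher_differentiable_on S f k" "higher_differentiable_on S g k"
  shows "higher_differentiable_on S (\<lambda>x. f x * g x) k"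
  using assms(2,3)
proof (induction k arbitrary: f g)
  case 0
  then show ?case by (simp add: continuous_on_mult)
next
  case (Suc k)
  have fg: "higher_differentiable_on S f k" "higher_differentiable_on S g k"
    using Suc.prems higher_differentiable_on_Suc_imp by blast+
  show ?case
    by (rule higher_differentiable_on_derivI[OF assms(1) has_derivative_mult])
      (use Suc fg in \<open>auto intro!: higher_differentiable_on_add[OF assms(1)]
         intro: higher_differentiable_on_has_derivative\<close>)
qed

lemma higher_differentiable_on_diff:
  assumes "open S" "higher_differentiable_on S f k" "higher_differentiable_on S g k"
  shows "higher_differentiable_on S (\<lambda>x. f x - g x) k"
  using higher_differentiable_on_add[OF assms(1,2)
      higher_differentiable_on_mult[OF assms(1) higher_differentiable_on_const[of S "-1"] assms(3)]]
  by simp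

lemma higher_differentiable_on_sum:
  assumes "open S" "\<And>i. i \<in> I \<Longrightarrow> higher_differentiable_on S (f i) k"
  shows "higher_differentiable_on S (\<lambda>x. \<Sum>i\<in>I. f i x) k"
  using assms(2)
  by (induction I rule: infinite_finite_induct) (auto intro: higher_differentiable_on_add[OF assms(1)])

text \<open>By the chain rule a directional derivative of \<open>f (g x)\<close> is a finite sum of
  derivatives of components of \<open>g\<close> times partial derivatives of \<open>f\<close>
  composed with \<open>g\<close>. The latter are again compositions with the same \<open>g\<close>,
  so the induction keeps \<open>g\<close> fixed and lets \<open>f\<close> vary.\<close>

lemma higher_differentiable_on_compose:
  fixes f :: "'b::euclidean_space \<Rightarrow> real" and g :: "'a::real_normed_vector \<Rightarrow> 'b"
  assumes "open S" "open T" "g ` S \<subseteq> T" "higher_differentiable_on T f k"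
    and "\<And>b. b \<in> Basis \<Longrightarrow> higher_differentiable_on S (\<lambda>x. g x \<bullet> b) k"
  shows "higher_differentiable_on S (\<lambda>x. f (g x)) k"
  using assms(4,5)
proof (induction k arbitrary: f)
  case 0
  have "continuous_on S g"
    using 0 by (subst continuous_on_componentwise) simp
  then show ?case
    using 0 assms(3) continuous_on_compose2[of T f S g] by simp
next
  case (Suc k)
  let ?Dg = "\<lambda>x v. \<Sum>b\<in>Basis. frechet_derivative (\<lambda>x. g x \<bullet> b) (at x) v *\<^sub>R b"
  have Dg: "(g has_derivative ?Dg x) (at x)" if "x \<in> S" for x
  proof (subst has_derivative_componentwise_within, intro ballI)
    fix b :: 'b assume b: "b \<in> Basis"
    have "?Dg x v \<bullet> b = frechet_derivative (\<lambda>x. g x \<bullet> b) (at x) v" for v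
      by (simp add: inner_sum_left_Basis b)
    then show "((\<lambda>x. g x \<bullet> b) has_derivative (\<lambda>v. ?Dg x v \<bullet> b)) (at x)"
      using higher_differentiable_on_has_derivative[OF Suc.prems(2)[OF b] that] by simp
  qed
  have Df: "(f has_derivative frechet_derivative f (at y)) (at y)" if "y \<in> T" for y
    using Suc.prems(1) that by (rule higher_differentiable_on_has_derivative)
  have D: "((\<lambda>x. f (g x)) has_derivative
      (\<lambda>v. \<Sum>b\<in>Basis. frechet_derivative (\<lambda>x. g x \<bullet> b) (at x) v * frechet_derivative f (at (g x)) b)) (at x)"
    if "x \<in> S" for x
  proof -
    have gx: "g x \<in> T" using that assms(3) by auto
    have "linear (frechet_derivative f (at (g x)))"
      using Df[OF gx] has_derivative_linear by blast
    then have "frechet_derivative f (at (g x)) (?Dg x v) =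
      (\<Sum>b\<in>Basis. frechet_derivative (\<lambda>x. g x \<bullet> b) (at x) v * frechet_derivative f (at (g x)) b)" for v
      by (simp add: linear_sum linear_scale)
    then show ?thesis
      using has_derivative_compose[OF Dg[OF that] Df[OF gx]] by simp
  qed
  have lower: "higher_differentiable_on T f k"
    "\<And>b. b \<in> Basis \<Longrightarrow> higher_differentiable_on S (\<lambda>x. g x \<bullet> b) k"
    by (rule higher_differentiable_on_Suc_imp, use Suc.prems in simp)+
  have "higher_differentiable_on S (\<lambda>x. frechet_derivative f (at (g x)) b) k" for b
    by (rule Suc.IH[OF _ lower(2)]) (use Suc.prems(1) in auto)
  then have "higher_differentiable_on S (\<lambda>x. \<Sum>b\<in>Basis. frechet_derivative (\<lambda>x. g x \<bullet> b) (at x) v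
        * frechet_derivative f (at (g x)) b) k" for v
    using Suc.prems(2)
    by (intro higher_differentiable_on_sum[OF assms(1)] higher_differentiable_on_mult[OF assms(1)]) auto
  with D show ?case
    by (rule higher_differentiable_on_derivI[OF assms(1)])
qed

section \<open>Smoothness of powers, the reciprocal and truncated powers on the real line\<close>

lemma higher_differentiable_on_compose_real:
  fixes h :: "real \<Rightarrow> real"
  assumes "open S" "open T" "f ` S \<subseteq> T" "higher_differentiable_on T h k" "higher_differentiable_on S f k"
  shows "higher_differentiable_on S (\<lambda>x. h (f x)) k"
  using higher_differentiable_on_compose[OF assms(1-4)] assms(5) by simp

lemma higher_differentiable_on_real_derivI:
  fixes h :: "real \<Rightarrow> real"
  assumes "open T" "\<And>x. x \<in> T \<Longrightarrow> (h has_real_derivative h' x) (at x)" "higher_differentiable_on T h' k"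
  shows "higher_differentiable_on T h (Suc k)"
  using assms
  by (intro higher_differentiable_on_derivI[where f' = "\<lambda>x v. h' x * v"])
    (auto simp: has_field_derivative_def intro!: higher_differentiable_on_mult)

lemma higher_differentiable_on_powr: "higher_differentiable_on {0<..} (\<lambda>x::real. x powr a) k"
proof (induction k arbitrary: a)
  case 0
  then show ?case by (auto intro!: continuous_intros)
next
  case (Suc k)
  show ?case
    by (rule higher_differentiable_on_real_derivI[where h' = "\<lambda>x. a * x powr (a - 1)"])
      (auto intro!: derivative_eq_intros higher_differentiable_on_mult Suc)
qed

lemma higher_differentiable_on_inverse: "higher_differentiable_on (- {0}) (inverse :: real \<Rightarrow> real) k"
proof (induction k)
  case 0
  then show ?case by (auto intro!: continuous_intros)
next
  case (Suc k)
  show ?case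
    by (rule higher_differentiable_on_real_derivI[where h' = "\<lambda>x. 0 - inverse x * inverse x"])
      (auto intro!: derivative_eq_intros higher_differentiable_on_mult higher_differentiable_on_diff Suc
        simp del: diff_0 simp: open_Compl)
qed

lemma has_real_derivative_max_0_power:
  "((\<lambda>x::real. max 0 x ^ Suc (Suc i)) has_real_derivative (of_nat (Suc (Suc i)) * max 0 x ^ Suc i)) (at x)"
proof (cases x "0::real" rule: linorder_cases)
  case less
  show ?thesis
    by (rule has_field_derivative_transform_within_open[where f = "\<lambda>_. 0" and S = "{..<0}"])
      (use less in \<open>auto simp: max_def\<close>)
next
  case greater
  have "((\<lambda>x. x ^ Suc (Suc i)) has_real_derivative (of_nat (Suc (Suc i)) * max 0 x ^ Suc i)) (at x)"
    using DERIV_pow[of "Suc (Suc i)" x] greater by (simp del: power_Suc of_nat_Suc)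
  then show ?thesis
    by (rule has_field_derivative_transform_within_open[where S = "{0<..}"]) (use greater in auto)
next
  case equal
  \<comment> \<open>At the kink the difference quotient equals \<open>max 0 h ^ Suc i\<close>, which
    tends to 0.\<close>
  have "((\<lambda>h::real. max 0 h ^ Suc i) \<longlongrightarrow> max 0 0 ^ Suc i) (at 0)"
    by (intro tendsto_intros)
  moreover have "\<forall>\<^sub>F h::real in at 0. max 0 h ^ Suc i = max 0 h ^ Suc (Suc i) / h"
    by (simp add: eventually_at_filter max_def)
  ultimately have "((\<lambda>h::real. max 0 h ^ Suc (Suc i) / h) \<longlongrightarrow> 0) (at 0)"
    using Lim_transform_eventually by fastforce
  then show ?thesis
    using equal by (simp add: has_field_derivative_iff)
qed

text \<open>Each derivative costs one power; the strict \<open>k < i\<close> leaves a positive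
  power, hence a continuous function, after \<open>k\<close> derivatives.\<close>

lemma higher_differentiable_on_max_0_power:
  "k < i \<Longrightarrow> higher_differentiable_on UNIV (\<lambda>x::real. max 0 x ^ i) k"
proof (induction k arbitrary: i)
  case 0
  then show ?case by (auto intro!: continuous_intros)
next
  case (Suc k)
  define j where "j = i - 2"
  with Suc.prems have i: "i = Suc (Suc j)"
    by simp
  have "higher_differentiable_on UNIV (\<lambda>x::real. of_nat (Suc (Suc j)) * max 0 x ^ Suc j) k"
    by (rule higher_differentiable_on_mult) (use Suc i in \<open>simp_all del: power_Suc of_nat_Suc\<close>)
  then show ?case
    unfolding i
    by (rule higher_differentiable_on_real_derivI[OF open_UNIV has_real_derivative_max_0_power])
qed

text \<open>Stated as an equivalence so that the choice made in \<open>frechet_derivative\<close>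
  transports along translations even at points without a derivative.\<close>

lemma has_derivative_shift_iff:
  "((\<lambda>x. f (c + x)) has_derivative D) (at x) \<longleftrightarrow> (f has_derivative D) (at (c + x))"
proof
  have shift: "((\<lambda>x. c + x) has_derivative (\<lambda>h. h)) (at x)" for c x :: 'a
    by (auto intro!: derivative_eq_intros)
  show "((\<lambda>x. f (c + x)) has_derivative D) (at x)" if "(f has_derivative D) (at (c + x))"
    using has_derivative_compose[OF shift that] .
  show "(f has_derivative D) (at (c + x))" if "((\<lambda>x. f (c + x)) has_derivative D) (at x)"
    using has_derivative_compose[OF shift[of "- c" "c + x"], of "\<lambda>x. f (c + x)" D] that by simp
qed

lemma frechet_derivative_shift:
  "frechet_derivative (\<lambda>x. f (c + x)) (at x) = frechet_derivative f (at (c + x))"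
  by (simp add: frechet_derivative_def has_derivative_shift_iff)

lemma differentiable_shift:
  "(\<lambda>x. f (c + x)) differentiable (at x) \<longleftrightarrow> f differentiable (at (c + x))"
  by (simp add: differentiable_def has_derivative_shift_iff)

lemma higher_differentiable_on_shift:
  assumes "higher_differentiable_on S f k"
  shows "higher_differentiable_on ((\<lambda>x. c + x) -` S) (\<lambda>x. f (c + x)) k"
  using assms
proof (induction k arbitrary: f)
  case 0
  then show ?case
    by (auto intro!: continuous_on_compose2[of S f] continuous_intros)
next
  case (Suc k)
  have "higher_differentiable_on ((\<lambda>x. c + x) -` S) (\<lambda>x. frechet_derivative f (at (c + x)) v) k" for v
    using Suc.IH[of "\<lambda>y. frechet_derivative f (at y) v"] Suc.prems by simp
  then show ?case
    using Suc.prems by (simp add: frechet_derivative_shift differentiable_shift)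
qed

section \<open>Plurisubharmonicity from convexity\<close>

lemma continuous_on_imp_upper_semicontinuous_on:
  "continuous_on S u \<Longrightarrow> upper_semicontinuous_on S u"
  unfolding upper_semicontinuous_on_def continuous_on_def by (blast intro: order_tendstoD(2))

text \<open>Pair antipodal points of the circle: the midpoint inequality bounds
  \<open>2 * v a\<close> by the sum of \<open>v\<close> over each pair, and integrating over a half
  circle covers the full circle once.\<close>

lemma subharmonic_on_if_midpoint_convex:
  assumes cont: "continuous_on D v"
    and mid: "\<And>a h. a \<in> D \<Longrightarrow> a + h \<in> D \<Longrightarrow> a - h \<in> D \<Longrightarrow> 2 * v a \<le> v (a + h) + v (a - h)"
  shows "subharmonic_on D v"
  unfolding subharmonic_on_def
proof (intro conjI allI impI)
  show "upper_semicontinuous_on D v"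
    using cont by (rule continuous_on_imp_upper_semicontinuous_on)
next
  fix a :: complex and r :: real
  assume "0 < r \<and> cball a r \<subseteq> D"
  then have r: "0 < r" and sub: "cball a r \<subseteq> D" by auto
  let ?f = "\<lambda>t. v (a + of_real r * cis t)"
  have inD: "a + of_real r * cis t \<in> D" "a - of_real r * cis t \<in> D" for t
    using r by (auto intro!: subsetD[OF sub] simp: dist_norm norm_mult)
  have cf: "continuous_on T ?f" for T
    by (rule continuous_on_compose2[OF cont]) (use inD in \<open>auto intro!: continuous_intros\<close>)
  have int: "?f integrable_on {s..t}" for s t
    by (rule integrable_continuous_real[OF cf])
  then show "?f integrable_on {0..2*pi}" .
  \<comment> \<open>Adding \<open>pi\<close> to the angle negates \<open>cis t\<close>, so the
    antipodal half is the integral over the second half circle.\<close>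
  have shift: "integral {0..pi} (\<lambda>t. v (a - of_real r * cis t)) = integral {pi..2*pi} ?f"
    using integral_shift[of 0 pi pi ?f] cf by (simp add: o_def cis_conv_exp distrib_left exp_add)
  have int': "(\<lambda>t. v (a - of_real r * cis t)) integrable_on {0..pi}"
    by (rule integrable_continuous_real, rule continuous_on_compose2[OF cont])
      (use inD in \<open>auto intro!: continuous_intros\<close>)
  have "2 * pi * v a = integral {0..pi} (\<lambda>t. 2 * v a)"
    by simp
  also have "\<dots> \<le> integral {0..pi} (\<lambda>t. ?f t + v (a - of_real r * cis t))"
    using int int' inD sub r by (intro integral_le integrable_add mid) auto
  also have "\<dots> = integral {0..pi} ?f + integral {pi..2*pi} ?f"
    using int int' shift by (simp add: integral_add)
  also have "\<dots> = integral {0..2*pi} ?f"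
    by (rule Henstock_Kurzweil_Integration.integral_combine) (use int in auto)
  finally show "v a \<le> 1 / (2*pi) * integral {0..2*pi} ?f"
    by (simp add: field_simps)
qed

lemma continuous_on_affine_line:
  fixes z w :: "complex^'n"
  shows "continuous_on S (\<lambda>\<zeta>. z + \<zeta> *s w)"
  unfolding vector_scalar_mult_def by (intro continuous_intros)

text \<open>A complex line is parametrised affinely, so midpoint convexity passes to its
  restriction, a function of one complex variable.\<close>

lemma plurisubharmonic_on_if_midpoint_convex:
  fixes u :: "complex^'n \<Rightarrow> real"
  assumes cont: "continuous_on S u"
    and mid: "\<And>a h. a \<in> S \<Longrightarrow> a + h \<in> S \<Longrightarrow> a - h \<in> S \<Longrightarrow> 2 * u a \<le> u (a + h) + u (a - h)"
  shows "plurisubharmonic_on S u"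
  unfolding plurisubharmonic_on_def
proof (intro conjI allI)
  show "upper_semicontinuous_on S u"
    using cont by (rule continuous_on_imp_upper_semicontinuous_on)
next
  fix z w :: "complex^'n"
  show "subharmonic_on {\<zeta>. z + \<zeta> *s w \<in> S} (\<lambda>\<zeta>. u (z + \<zeta> *s w))"
  proof (rule subharmonic_on_if_midpoint_convex)
    show "continuous_on {\<zeta>. z + \<zeta> *s w \<in> S} (\<lambda>\<zeta>. u (z + \<zeta> *s w))"
      by (rule continuous_on_compose2[OF cont continuous_on_affine_line]) auto
  next
    fix a h
    assume "a \<in> {\<zeta>. z + \<zeta> *s w \<in> S}" "a + h \<in> {\<zeta>. z + \<zeta> *s w \<in> S}" "a - h \<in> {\<zeta>. z + \<zeta> *s w \<in> S}"
    moreover have "z + (a + h) *s w = (z + a *s w) + h *s w" "z + (a - h) *s w = (z + a *s w) - h *s w"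
      by (simp_all add: vec_eq_iff algebra_simps)
    ultimately show "2 * u (z + a *s w) \<le> u (z + (a + h) *s w) + u (z + (a - h) *s w)"
      using mid[of "z + a *s w" "h *s w"] by (simp add: algebra_simps)
  qed
qed

section \<open>Tangent inequalities for powers and the resulting strict convexity\<close>

lemma powr_ge_tangent_at_1:
  fixes t p :: real
  assumes "1 \<le> p" "0 < t"
  shows "1 + p * (t - 1) \<le> t powr p"
proof -
  have "t powr p - 1 powr p \<ge> p * 1 powr (p - 1) * (t - 1)"
    by (rule convex_on_imp_above_tangent[OF powr_convex[OF assms(1)]])
      (use assms in \<open>auto intro!: derivative_eq_intros simp: is_interval_connected interior_open\<close>)
  then show ?thesis by simp
qed

text \<open>The convex case with exponent \<open>1 / p\<close>, applied at the point
  \<open>t powr p\<close>.\<close>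

lemma powr_le_tangent_at_1:
  fixes t p :: real
  assumes "0 < p" "p \<le> 1" "0 < t"
  shows "t powr p \<le> 1 + p * (t - 1)"
  using powr_ge_tangent_at_1[of "1 / p" "t powr p"] assms by (simp add: powr_powr field_simps)

text \<open>The function \<open>x powr \<eta> * y powr (1 - \<eta>)\<close> is homogeneous of degree
  one, so one tangent plane serves the whole ray \<open>x / y = q\<close>. With
  \<open>t = x / (y * q)\<close> the claim is the one-variable tangent inequality at 1, multiplied
  by \<open>y * q powr \<eta>\<close>.\<close>

lemma powr_mult_powr_tangent:
  fixes x y q \<eta> :: real
  assumes "0 < \<eta>" "0 < x" "0 < y" "0 < q"
  shows "sgn (\<eta> - 1) * (\<eta> * q powr (\<eta> - 1) * x + (1 - \<eta>) * q powr \<eta> * y)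
      \<le> sgn (\<eta> - 1) * (x powr \<eta> * y powr (1 - \<eta>))"
proof -
  define t where "t = x / (y * q)"
  have t: "0 < t" using assms by (simp add: t_def)
  have "sgn (\<eta> - 1) * (1 + \<eta> * (t - 1)) \<le> sgn (\<eta> - 1) * t powr \<eta>"
    using powr_ge_tangent_at_1[of \<eta> t] powr_le_tangent_at_1[of \<eta> t] assms(1) t
    by (cases \<eta> "1::real" rule: linorder_cases) auto
  then have "(y * q powr \<eta>) * (sgn (\<eta> - 1) * (1 + \<eta> * (t - 1))) \<le> (y * q powr \<eta>) * (sgn (\<eta> - 1) * t powr \<eta>)"
    by (rule mult_left_mono) (use assms in auto)
  moreover have "y * q powr \<eta> * t powr \<eta> = x powr \<eta> * y powr (1 - \<eta>)"
    using assms by (simp add: t_def powr_divide powr_mult powr_diff)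
  moreover have "y * q powr \<eta> * (1 + \<eta> * (t - 1)) = \<eta> * q powr (\<eta> - 1) * x + (1 - \<eta>) * q powr \<eta> * y"
    using assms by (simp add: t_def powr_diff field_simps)
  ultimately show ?thesis
    by (metis mult.left_commute)
qed

lemma convex_on_UNIV_midpoint:
  assumes "convex_on UNIV f"
  shows "2 * f a \<le> f (a + h) + f (a - h)"
proof -
  have "f ((1/2) *\<^sub>R (a + h) + (1/2) *\<^sub>R (a - h)) \<le> (1/2) * f (a + h) + (1/2) * f (a - h)"
    using convex_onD[OF assms, of "1/2" "a + h" "a - h"] by simp
  moreover have "(1/2) *\<^sub>R (a + h) + (1/2) *\<^sub>R (a - h) = a"
    by (simp flip: scaleR_add_right)
  ultimately show ?thesis by simp
qed

lemma norm_parallelogram: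
  fixes a h :: "'a::real_inner"
  shows "(norm (a + h))\<^sup>2 + (norm (a - h))\<^sup>2 = 2 * (norm a)\<^sup>2 + 2 * (norm h)\<^sup>2"
  by (simp add: power2_norm_eq_inner inner_simps inner_commute)

text \<open>The factor \<open>sgn (\<eta> - 1)\<close> treats the inside (\<open>f < 0\<close>, \<open>\<eta> < 1\<close>) and the outside
  (\<open>f > 0\<close>, \<open>\<eta> > 1\<close>) of the domain at once.  The tangent plane at \<open>a\<close> supports \<open>u\<close> from below
  by a convex function whose Hessian is at least \<open>2 * \<kappa> a\<close>.\<close>

lemma strictly_plurisubharmonic_on_powr:
  fixes f u :: "complex^'n \<Rightarrow> real"
  assumes \<eta>: "0 < \<eta>" "\<eta> \<noteq> 1"
    and S: "open S" "S \<subseteq> ball 0 R"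
    and f: "convex_on UNIV f" "continuous_on S f" "\<And>z. z \<in> S \<Longrightarrow> 0 < sgn (\<eta> - 1) * f z"
    and u: "\<And>z. z \<in> S \<Longrightarrow>
      u z = sgn (\<eta> - 1) * ((sgn (\<eta> - 1) * f z) powr \<eta> * (R\<^sup>2 - (norm z)\<^sup>2) powr (1 - \<eta>))"
  shows "strictly_plurisubharmonic_on S u"
  unfolding strictly_plurisubharmonic_on_def
proof (intro ballI)
  fix p assume p: "p \<in> S"
  define \<sigma> where "\<sigma> = sgn (\<eta> - 1)"
  define g where "g z = R\<^sup>2 - (norm z)\<^sup>2" for z :: "complex^'n"
  define q where "q z = \<sigma> * f z / g z" for z
  define \<kappa> where "\<kappa> z = \<bar>\<eta> - 1\<bar> * q z powr \<eta>" for z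
  have g_pos: "0 < g z" if "z \<in> S" for z
    using that S(2) power_strict_mono[of "norm z" R 2] by (auto simp: g_def subset_eq)
  have f_pos: "0 < \<sigma> * f z" if "z \<in> S" for z
    using f(3)[OF that] by (simp add: \<sigma>_def)
  have q_pos: "0 < q z" if "z \<in> S" for z
    using g_pos[OF that] f_pos[OF that] by (simp add: q_def)
  have \<kappa>_pos: "0 < \<kappa> z" if "z \<in> S" for z
    using q_pos[OF that] \<eta> by (simp add: \<kappa>_def)
  have u': "u z = \<sigma> * ((\<sigma> * f z) powr \<eta> * g z powr (1 - \<eta>))" if "z \<in> S" for z
    using u[OF that] by (simp add: g_def \<sigma>_def)
  have cont_g: "continuous_on S g"
    unfolding g_def by (intro continuous_intros)
  have cont_q: "continuous_on S q"
    unfolding q_def using g_pos by (intro continuous_intros f(2) cont_g) force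
  have cont_\<kappa>: "continuous_on S \<kappa>"
    unfolding \<kappa>_def using q_pos by (intro continuous_intros cont_q) force
  have "continuous_on S (\<lambda>z. \<sigma> * ((\<sigma> * f z) powr \<eta> * g z powr (1 - \<eta>)))"
    using g_pos f_pos by (intro continuous_intros f(2) cont_g) force+
  then have cont_u: "continuous_on S u"
    using u' by (simp cong: continuous_on_cong)
  \<comment> \<open>Since \<open>\<kappa>\<close> is continuous and positive at \<open>p\<close>,
    halving leaves room for one constant \<open>c\<close> below \<open>\<kappa>\<close> on the whole
    neighbourhood \<open>W\<close>.\<close>
  define c where "c = \<kappa> p / 2"
  define W where "W = S \<inter> \<kappa> -` {c<..}"
  have "open W"
    unfolding W_def by (rule continuous_open_preimage[OF cont_\<kappa> S(1)]) auto
  moreover have "p \<in> W"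
    using p \<kappa>_pos[OF p] by (simp add: W_def c_def)
  moreover have "plurisubharmonic_on W (\<lambda>z. u z - c * (norm z)\<^sup>2)"
  proof (rule plurisubharmonic_on_if_midpoint_convex)
    show "continuous_on W (\<lambda>z. u z - c * (norm z)\<^sup>2)"
      using cont_u by (intro continuous_intros) (auto simp: W_def intro: continuous_on_subset)
  next
    fix a h assume "a \<in> W" and ah: "a + h \<in> W" "a - h \<in> W"
    then have a: "a \<in> S" "c < \<kappa> a" and ah: "a + h \<in> S" "a - h \<in> S"
      by (auto simp: W_def)
    \<comment> \<open>Coefficients of the tangent plane for the ratio \<open>q a\<close>, expressed
      in \<open>f\<close> and \<open>g\<close>; in \<open>A\<close> the two factors
      \<open>\<sigma>\<close> cancel because \<open>x\<close> stands for
      \<open>\<sigma> * f\<close>.\<close>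
    define A where "A = \<eta> * q a powr (\<eta> - 1)"
    define B where "B = \<sigma> * (1 - \<eta>) * q a powr \<eta>"
    have \<sigma>2: "\<sigma> * (\<sigma> * t) = t" for t
      using \<eta>(2) by (simp add: \<sigma>_def sgn_if)
    have tangent: "A * f z + B * g z \<le> u z" if "z \<in> S" for z
      using powr_mult_powr_tangent[OF \<eta>(1) f_pos[OF that] g_pos[OF that] q_pos[OF a(1)]]
      using \<sigma>2 by (simp add: u'[OF that] A_def B_def algebra_simps flip: \<sigma>_def)
    \<comment> \<open>At \<open>a\<close> the ratio of \<open>\<sigma> * f\<close> to
      \<open>g\<close> is exactly \<open>q a\<close>, so the tangent inequality becomes an
      equality.\<close>
    have touch: "A * f a + B * g a = u a"
    proof -
      have "q a * g a = \<sigma> * f a"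
        using g_pos[OF a(1)] by (simp add: q_def)
      then have fa: "f a = \<sigma> * (q a * g a)"
        using \<sigma>2 by simp
      have "u a = \<sigma> * (q a powr \<eta> * g a)"
        using u'[OF a(1)] \<open>q a * g a = \<sigma> * f a\<close>[symmetric] q_pos[OF a(1)] g_pos[OF a(1)]
        by (simp add: powr_mult powr_diff)
      moreover have "A * f a = \<sigma> * \<eta> * (q a powr \<eta> * g a)"
        using q_pos[OF a(1)] by (simp add: A_def fa powr_diff)
      ultimately show ?thesis
        by (simp add: B_def algebra_simps)
    qed
    have "0 \<le> A" using \<eta>(1) by (simp add: A_def)
    have "B = - \<kappa> a"
      by (simp add: B_def \<kappa>_def \<sigma>_def sgn_if algebra_simps)
    \<comment> \<open>The source of strictness: as \<open>B\<close> is \<open>- \<kappa> a\<close>,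
      the parallelogram defect of \<open>g\<close> contributes a gain of
      \<open>2 * \<kappa> a\<close> times the squared norm of \<open>h\<close>, while
      \<open>f\<close> contributes only weak convexity.\<close>
    have gg: "g (a + h) + g (a - h) = 2 * g a - 2 * (norm h)\<^sup>2"
      using norm_parallelogram[of a h] by (simp add: g_def)
    have "2 * u a + 2 * c * (norm h)\<^sup>2 \<le> 2 * u a + 2 * \<kappa> a * (norm h)\<^sup>2"
      using a(2) by (simp add: mult_right_mono)
    also have "\<dots> = A * (2 * f a) + B * (g (a + h) + g (a - h))"
      unfolding gg touch[symmetric] \<open>B = - \<kappa> a\<close> by (simp add: algebra_simps)
    also have "\<dots> \<le> A * (f (a + h) + f (a - h)) + B * (g (a + h) + g (a - h))"
      using convex_on_UNIV_midpoint[OF f(1)] \<open>0 \<le> A\<close> by (intro add_right_mono mult_left_mono)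
    also have "\<dots> = (A * f (a + h) + B * g (a + h)) + (A * f (a - h) + B * g (a - h))"
      by (simp add: algebra_simps)
    also have "\<dots> \<le> u (a + h) + u (a - h)"
      by (intro add_mono tangent ah)
    moreover have "c * (norm (a + h))\<^sup>2 + c * (norm (a - h))\<^sup>2 = 2 * c * (norm a)\<^sup>2 + 2 * c * (norm h)\<^sup>2"
      using arg_cong[OF norm_parallelogram[of a h], of "\<lambda>t. c * t"] by (simp add: algebra_simps)
    ultimately show "2 * (u a - c * (norm a)\<^sup>2)
        \<le> (u (a + h) - c * (norm (a + h))\<^sup>2) + (u (a - h) - c * (norm (a - h))\<^sup>2)"
      by (simp add: algebra_simps)
  qed
  ultimately show "\<exists>W c. open W \<and> p \<in> W \<and> W \<subseteq> S \<and> 0 < c \<and>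
      plurisubharmonic_on W (\<lambda>z. u z - c * (norm z)\<^sup>2)"
    using \<kappa>_pos[OF p] by (intro exI[of _ W] exI[of _ c]) (auto simp: W_def c_def)
qed

section \<open>The gauge of a bounded open convex set\<close>

definition gauge_fun :: "'a::real_normed_vector set \<Rightarrow> 'a \<Rightarrow> real" where
  "gauge_fun A x = Inf {t. 0 < t \<and> x /\<^sub>R t \<in> A}"

text \<open>No symmetry is assumed, so the gauge is only positively homogeneous. Openness at 0 makes
  it finite and Lipschitz, boundedness makes it positive off 0, and so the radial projection
  \<open>x /\<^sub>R N x\<close> onto the boundary is defined and continuous there.\<close>

locale convex_body =
  fixes A :: "'a::real_normed_vector set"
  assumes op: "open A" and cvx: "convex A" and bdd: "bounded A" and zero: "0 \<in> A"
begin

abbreviation N where "N \<equiv> gauge_fun A"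

lemma scale_in:
  assumes "x \<in> A" "0 \<le> s" "s \<le> 1"
  shows "s *\<^sub>R x \<in> A"
  using convexD[OF cvx assms(1) zero, of s "1 - s"] assms by simp

lemma absorbing: "\<exists>t>0. x /\<^sub>R t \<in> A"
proof -
  have "((\<lambda>t. inverse t *\<^sub>R x) \<longlongrightarrow> 0 *\<^sub>R x) at_top"
    by (intro tendsto_intros tendsto_inverse_0_at_top filterlim_ident)
  then have "\<forall>\<^sub>F t in at_top. x /\<^sub>R t \<in> A"
    using op zero by (intro topological_tendstoD) auto
  then have "\<forall>\<^sub>F t in at_top. 0 < t \<and> x /\<^sub>R t \<in> A"
    using eventually_gt_at_top[of 0] by eventually_elim simp
  from eventually_happens'[OF trivial_limit_at_top_linorder this] show ?thesis
    by simp
qed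

lemma N_nonneg: "0 \<le> N x"
  unfolding gauge_fun_def using absorbing[of x] by (intro cInf_greatest) auto

text \<open>If \<open>x /\<^sub>R t\<close> lies in the open set, so does
  \<open>x /\<^sub>R s\<close> for some smaller \<open>s\<close>, which makes the inequality strict.
  Conversely, an admissible \<open>s < t\<close> reaches \<open>t\<close> by shrinking towards 0.
  Later arguments use this equivalence instead of the infimum.\<close>

lemma N_less_iff:
  assumes "0 < t"
  shows "N x < t \<longleftrightarrow> x /\<^sub>R t \<in> A"
proof
  assume "N x < t"
  then obtain s where s: "0 < s" "x /\<^sub>R s \<in> A" "s < t"
    using cInf_lessD[of "{t. 0 < t \<and> x /\<^sub>R t \<in> A}" t] absorbing[of x] by (auto simp: gauge_fun_def)
  then have "(s / t) *\<^sub>R (x /\<^sub>R s) \<in> A"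
    using assms by (intro scale_in[OF s(2)]) auto
  then show "x /\<^sub>R t \<in> A"
    using s by (simp add: field_simps)
next
  assume t: "x /\<^sub>R t \<in> A"
  have "isCont (\<lambda>s. x /\<^sub>R s) t"
    using assms by (intro continuous_intros) auto
  then have "((\<lambda>s. x /\<^sub>R s) \<longlongrightarrow> x /\<^sub>R t) (at_left t)"
    by (auto simp: isCont_def filterlim_at_split)
  then have "\<forall>\<^sub>F s in at_left t. x /\<^sub>R s \<in> A"
    using op t by (rule topological_tendstoD)
  moreover have "\<forall>\<^sub>F s in at_left t. 0 < s \<and> s < t"
    using assms eventually_at_left_real by fastforce
  ultimately have "\<forall>\<^sub>F s in at_left t. 0 < s \<and> s < t \<and> x /\<^sub>R s \<in> A"
    by eventually_elim simp
  from eventually_happens'[OF trivial_limit_at_left_real this]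
  obtain s where s: "0 < s" "s < t" "x /\<^sub>R s \<in> A"
    by blast
  have "N x \<le> s"
    unfolding gauge_fun_def by (rule cInf_lower) (use s in \<open>auto intro!: bdd_belowI[of _ 0]\<close>)
  with s show "N x < t" by simp
qed

lemma in_iff_N_less: "x \<in> A \<longleftrightarrow> N x < 1"
  using N_less_iff[of 1 x] by simp

lemma N_scale:
  assumes "0 < s"
  shows "N (s *\<^sub>R x) = s * N x"
proof (rule antisym)
  have *: "N (s *\<^sub>R x) < t \<longleftrightarrow> s * N x < t" if "0 < t" for t
    using N_less_iff[OF that, of "s *\<^sub>R x"] N_less_iff[of "t / s" x] assms that
    by (simp add: field_simps)
  show "N (s *\<^sub>R x) \<le> s * N x"
    by (rule dense_ge) (use * N_nonneg[of x] assms in \<open>smt (verit) mult_nonneg_nonneg\<close>)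
  show "s * N x \<le> N (s *\<^sub>R x)"
    by (rule dense_ge) (use * N_nonneg[of "s *\<^sub>R x"] in \<open>smt (verit)\<close>)
qed

text \<open>For \<open>s\<close>, \<open>t\<close> slightly above the two gauges,
  \<open>(x + y) /\<^sub>R (s + t)\<close> is a convex combination of the points
  \<open>x /\<^sub>R s\<close> and \<open>y /\<^sub>R t\<close> of \<open>A\<close>.\<close>

lemma N_triangle: "N (x + y) \<le> N x + N y"
proof (rule field_le_epsilon)
  fix e :: real assume e: "0 < e"
  define s t where "s = N x + e / 2" and "t = N y + e / 2"
  have st: "0 < s" "0 < t" "N x < s" "N y < t"
    using N_nonneg[of x] N_nonneg[of y] e by (auto simp: s_def t_def)
  have "(s / (s + t)) *\<^sub>R (x /\<^sub>R s) + (t / (s + t)) *\<^sub>R (y /\<^sub>R t) \<in> A"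
    using st N_less_iff by (intro convexD[OF cvx]) (auto simp flip: add_divide_distrib)
  moreover have "(u / (s + t)) *\<^sub>R (a /\<^sub>R u) = a /\<^sub>R (s + t)" if "0 < u" for a :: 'a and u
    using that by (simp add: divide_inverse)
  ultimately have "(x + y) /\<^sub>R (s + t) \<in> A"
    using st by (simp add: scaleR_add_right inverse_eq_divide)
  then show "N (x + y) \<le> N x + N y + e"
    using N_less_iff[of "s + t" "x + y"] st by (simp add: s_def t_def)
qed

lemma N_convex: "convex_on UNIV N"
proof (rule convex_onI)
  fix t :: real and x y
  assume t: "0 < t" "t < 1"
  have "N ((1 - t) *\<^sub>R x + t *\<^sub>R y) \<le> N ((1 - t) *\<^sub>R x) + N (t *\<^sub>R y)"
    by (rule N_triangle)
  then show "N ((1 - t) *\<^sub>R x + t *\<^sub>R y) \<le> (1 - t) * N x + t * N y"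
    using t by (simp add: N_scale)
qed simp

lemma N_0 [simp]: "N 0 = 0"
  using N_scale[of 2 0] by simp

lemma N_pos:
  assumes "x \<noteq> 0"
  shows "0 < N x"
proof (rule ccontr)
  assume "\<not> 0 < N x"
  then have N: "N x < t" if "0 < t" for t using that by simp
  obtain B where B: "0 < B" "\<And>y. y \<in> A \<Longrightarrow> norm y \<le> B"
    using bdd bounded_pos by blast
  \<comment> \<open>With this \<open>t\<close> the rescaled point has norm \<open>2 * B\<close>,
    beyond the bound on \<open>A\<close>.\<close>
  define t where "t = norm x / (2 * B)"
  have "0 < t" using assms B by (simp add: t_def)
  then have "norm (x /\<^sub>R t) \<le> B"
    using N_less_iff N B by blast
  then show False
    using assms B by (simp add: t_def)
qed

lemma N_Lipschitz:
  obtains L where "0 < L" "\<And>x y. \<bar>N x - N y\<bar> \<le> L * norm (x - y)"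
proof -
  obtain e where e: "0 < e" "ball 0 e \<subseteq> A"
    using op zero openE by blast
  \<comment> \<open>The factor 2 puts the rescaled point at norm \<open>e / 2\<close>, strictly
    inside the ball; subadditivity then turns this linear bound into a Lipschitz bound.\<close>
  have bound: "N x \<le> (2 / e) * norm x" for x
  proof (cases "x = 0")
    case False
    then have "x /\<^sub>R ((2 / e) * norm x) \<in> ball 0 e"
      using e(1) by simp
    then show ?thesis
      using e N_less_iff[of "(2 / e) * norm x" x] False by fastforce
  qed simp
  have "N x \<le> N y + (2 / e) * norm (x - y)" for x y
    using N_triangle[of "x - y" y] bound[of "x - y"] by simp
  from this this[of y x for x y] have "\<bar>N x - N y\<bar> \<le> (2 / e) * norm (x - y)" for x y
    by (smt (verit) norm_minus_commute)
  then show ?thesis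
    using that[of "2 / e"] e(1) by simp
qed

lemma N_continuous_on: "continuous_on S N"
proof -
  obtain L where L: "0 < L" "\<And>x y. \<bar>N x - N y\<bar> \<le> L * norm (x - y)"
    using N_Lipschitz by blast
  then have "L-lipschitz_on S N"
    by (intro lipschitz_onI) (auto simp: dist_norm)
  then show ?thesis
    by (rule lipschitz_on_continuous_on)
qed

section \<open>The boundary as a level set of the gauge, and the derivative of the gauge\<close>

lemma closure_eq: "closure A = {x. N x \<le> 1}"
proof
  have "closed {x. N x \<le> 1}"
    by (intro closed_Collect_le N_continuous_on continuous_intros)
  then show "closure A \<subseteq> {x. N x \<le> 1}"
    by (rule closure_minimal[rotated]) (auto simp: in_iff_N_less)
  show "{x. N x \<le> 1} \<subseteq> closure A"
  proof
    fix x assume "x \<in> {x. N x \<le> 1}"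
    then have x: "N x \<le> 1" by simp
    have "((\<lambda>t. t *\<^sub>R x) \<longlongrightarrow> 1 *\<^sub>R x) (at_left 1)"
      by (intro tendsto_intros)
    moreover have "\<forall>\<^sub>F t in at_left 1. t *\<^sub>R x \<in> A"
    proof -
      have "\<forall>\<^sub>F t::real in at_left 1. 0 < t \<and> t < 1"
        using eventually_at_left_real[of 0 "1::real"] by simp
      then show ?thesis
      proof eventually_elim
        case (elim t)
        then have "t * N x \<le> t * 1" using x by (intro mult_left_mono) auto
        also have "\<dots> < 1" using elim by simp
        finally show ?case using elim by (simp add: in_iff_N_less N_scale)
      qed
    qed
    ultimately show "x \<in> closure A"
      by (intro Lim_in_closed_set[of "closure A" "\<lambda>t. t *\<^sub>R x" "at_left 1"])
        (auto elim!: eventually_mono intro: subsetD[OF closure_subset])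
  qed
qed

lemma frontier_eq: "frontier A = {x. N x = 1}"
  by (auto simp: frontier_def closure_eq interior_open[OF op] in_iff_N_less)

text \<open>Since \<open>r\<close> vanishes at the radial projections \<open>x / N x\<close>, differentiability of \<open>r\<close> at the single
  point \<open>x0 / N x0\<close> together with the Lipschitz bound on \<open>N\<close> already determines the derivative.\<close>

lemma N_has_derivative:
  assumes x0: "x0 \<noteq> 0"
    and r: "(r has_derivative D) (at (x0 /\<^sub>R N x0))"
    and vanish: "\<forall>\<^sub>F x in at x0. r (x /\<^sub>R N x) = 0" "r (x0 /\<^sub>R N x0) = (0::real)"
    and D: "D (x0 /\<^sub>R N x0) \<noteq> 0"
  shows "(N has_derivative (\<lambda>v. D v / D (x0 /\<^sub>R N x0))) (at x0)"
  unfolding has_derivative_at_alt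
proof (intro conjI allI impI)
  define p where "p = x0 /\<^sub>R N x0"
  obtain L where L: "0 < L" "\<And>x y. \<bar>N x - N y\<bar> \<le> L * norm (x - y)"
    using N_Lipschitz by blast
  have bl: "bounded_linear D"
    using r has_derivative_bounded_linear by blast
  then interpret D: bounded_linear D .
  show "bounded_linear (\<lambda>v. D v / D (x0 /\<^sub>R N x0))"
    using bl by (rule bounded_linear_divide[THEN bounded_linear_compose])
  fix \<epsilon> :: real assume \<epsilon>: "0 < \<epsilon>"
  define K where "K = 1 + L * norm p"
  have K: "0 < K" using L by (simp add: K_def add_pos_nonneg)
  \<comment> \<open>Chosen to absorb the estimate of \<open>norm h\<close> by
    \<open>K * norm (x - x0)\<close> and the final division by \<open>D p\<close>.\<close>
  define \<epsilon>' where "\<epsilon>' = \<epsilon> * \<bar>D p\<bar> / K"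
  have Dp: "D p \<noteq> 0" using D by (simp add: p_def)
  then have \<epsilon>': "0 < \<epsilon>'" using \<epsilon> K by (simp add: \<epsilon>'_def)
  obtain d where d: "0 < d"
    "\<And>y. norm (y - p) < d \<Longrightarrow> norm (r y - r p - D (y - p)) \<le> \<epsilon>' * norm (y - p)"
    using r \<epsilon>' unfolding has_derivative_at_alt p_def[symmetric] by blast
  have "isCont N x0"
    using N_continuous_on[of UNIV] by (simp add: continuous_on_eq_continuous_at)
  then have "((\<lambda>x. x /\<^sub>R N x) \<longlongrightarrow> p) (at x0)"
    unfolding p_def using N_pos[OF x0] by (intro tendsto_intros) (auto simp: isCont_def)
  then have "\<forall>\<^sub>F x in at x0. dist (x /\<^sub>R N x) p < d"
    using d(1) by (rule tendstoD)
  moreover have "\<forall>\<^sub>F x in at x0. x \<noteq> 0"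
    by (rule tendsto_imp_eventually_ne[OF tendsto_ident_at x0])
  ultimately have "\<forall>\<^sub>F x in at x0. dist (x /\<^sub>R N x) p < d \<and> x \<noteq> 0 \<and> r (x /\<^sub>R N x) = 0"
    using vanish(1) by eventually_elim simp
  then obtain d' where d': "0 < d'"
    "\<And>x. x \<noteq> x0 \<Longrightarrow> dist x x0 < d' \<Longrightarrow> dist (x /\<^sub>R N x) p < d \<and> x \<noteq> 0 \<and> r (x /\<^sub>R N x) = 0"
    by (auto simp: eventually_at)
  show "\<exists>d>0. \<forall>y. norm (y - x0) < d \<longrightarrow>
      norm (N y - N x0 - D (y - x0) / D (x0 /\<^sub>R N x0)) \<le> \<epsilon> * norm (y - x0)"
  proof (intro exI[of _ d'] conjI allI impI d'(1))
    fix x assume x: "norm (x - x0) < d'"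
    show "norm (N x - N x0 - D (x - x0) / D (x0 /\<^sub>R N x0)) \<le> \<epsilon> * norm (x - x0)"
    proof (cases "x = x0")
      case False
      \<comment> \<open>This is \<open>N x\<close> times the displacement of the radial projection
        from \<open>p\<close>. Moreover \<open>D h\<close> is, up to sign, \<open>D p\<close> times
        the error in the claimed linear approximation of \<open>N\<close>, so bounding
        \<open>D h\<close> suffices.\<close>
      define h where "h = (x - x0) - (N x - N x0) *\<^sub>R p"
      from d'(2)[OF False] x have xx: "dist (x /\<^sub>R N x) p < d" "x \<noteq> 0" "r (x /\<^sub>R N x) = 0"
        by (auto simp: dist_norm)
      have Nx: "0 < N x" "0 < N x0" using N_pos xx x0 by auto
      have x0p: "x0 = N x0 *\<^sub>R p" using Nx by (simp add: p_def)
      have h: "N x *\<^sub>R (x /\<^sub>R N x - p) = h"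
        unfolding h_def using Nx by (subst x0p) (simp add: algebra_simps)
      have "norm (r (x /\<^sub>R N x) - r p - D (x /\<^sub>R N x - p)) \<le> \<epsilon>' * norm (x /\<^sub>R N x - p)"
        using xx by (intro d(2)) (simp add: dist_norm)
      then have "\<bar>D (x /\<^sub>R N x - p)\<bar> \<le> \<epsilon>' * norm (x /\<^sub>R N x - p)"
        using xx vanish(2) by (simp add: p_def)
      then have "N x * \<bar>D (x /\<^sub>R N x - p)\<bar> \<le> N x * (\<epsilon>' * norm (x /\<^sub>R N x - p))"
        using Nx by (intro mult_left_mono) auto
      moreover have "N x * \<bar>D (x /\<^sub>R N x - p)\<bar> = \<bar>D h\<bar>"
        using Nx by (simp add: D.scaleR abs_mult flip: h)
      moreover have "N x * (\<epsilon>' * norm (x /\<^sub>R N x - p)) = \<epsilon>' * norm h"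
        using Nx by (simp flip: h)
      ultimately have "\<bar>D h\<bar> \<le> \<epsilon>' * norm h" by simp
      also have "norm h \<le> norm (x - x0) + \<bar>N x - N x0\<bar> * norm p"
        unfolding h_def by (rule order_trans[OF norm_triangle_ineq4]) simp
      also have "\<dots> \<le> norm (x - x0) + (L * norm (x - x0)) * norm p"
        by (intro add_left_mono mult_right_mono L(2)) auto
      also have "\<dots> = K * norm (x - x0)"
        by (simp add: K_def algebra_simps)
      finally have Dh: "\<bar>D h\<bar> \<le> \<epsilon>' * (K * norm (x - x0))"
        using \<epsilon>' by simp
      have "D h = D (x - x0) - (N x - N x0) * D p"
        by (simp only: h_def D.diff D.scaleR real_scaleR_def)
      then have "N x - N x0 - D (x - x0) / D p = - D h / D p"
        using Dp by (simp add: diff_divide_distrib)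
      then have "norm (N x - N x0 - D (x - x0) / D p) = \<bar>D h\<bar> / \<bar>D p\<bar>"
        by (simp add: abs_divide)
      also have "\<dots> \<le> \<epsilon>' * (K * norm (x - x0)) / \<bar>D p\<bar>"
        using Dh by (rule divide_right_mono) simp
      also have "\<dots> = \<epsilon> * norm (x - x0)"
        using K Dp by (simp add: \<epsilon>'_def)
      finally show ?thesis by (simp add: p_def)
    qed simp
  qed
qed

text \<open>Points of the segment from \<open>p\<close> to \<open>b \<in> A\<close> lie in
  \<open>A\<close> except for \<open>p\<close> itself, so \<open>r\<close> is negative on it near
  \<open>p\<close>. This yields \<open>r p = 0\<close> by continuity and
  \<open>D (b - p) \<le> 0\<close>. Choosing \<open>b\<close> as a small multiple of a vector on
  which \<open>D\<close> is positive gives \<open>D p > 0\<close>: the radial direction is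
  transversal to the boundary.\<close>

lemma local_defining_function_frontier:
  assumes U: "open U" "p \<in> U" "p \<in> frontier A" "A \<inter> U = {z \<in> U. r z < (0::real)}"
    and r: "(r has_derivative D) (at p)" "D \<noteq> (\<lambda>_. 0)"
  shows "r p = 0" "0 < D p"
proof -
  have Np: "N p = 1" using U(3) by (simp add: frontier_eq)
  interpret D: bounded_linear D
    using r has_derivative_bounded_linear by blast
  have seg: "\<forall>\<^sub>F s in at_right 0. r (p + s *\<^sub>R (b - p)) < 0" if b: "b \<in> A" for b
  proof -
    have "((\<lambda>s. p + s *\<^sub>R (b - p)) \<longlongrightarrow> p + 0 *\<^sub>R (b - p)) (at_right 0)"
      by (intro tendsto_intros)
    then have "\<forall>\<^sub>F s in at_right 0. p + s *\<^sub>R (b - p) \<in> U"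
      using U(1,2) by (intro topological_tendstoD) auto
    moreover have "\<forall>\<^sub>F s::real in at_right 0. 0 < s \<and> s < 1"
      using eventually_at_right_real[of 0 "1::real"] by simp
    ultimately show ?thesis
    proof eventually_elim
      case (elim s)
      have "N ((1 - s) *\<^sub>R p + s *\<^sub>R b) \<le> (1 - s) * N p + s * N b"
        using elim by (intro convex_onD[OF N_convex]) auto
      also have "\<dots> < (1 - s) * 1 + s * 1"
        using b elim Np by (simp add: in_iff_N_less)
      finally have "p + s *\<^sub>R (b - p) \<in> A"
        by (simp add: in_iff_N_less algebra_simps)
      then show ?case using elim U(4) by blast
    qed
  qed
  have "isCont r p"
    using r(1) has_derivative_continuous by blast
  have "((\<lambda>s. r (p + s *\<^sub>R (0 - p))) \<longlongrightarrow> r (p + 0 *\<^sub>R (0 - p))) (at_right 0)"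
    by (rule isCont_tendsto_compose[where g = r]) (use \<open>isCont r p\<close> in \<open>auto intro!: tendsto_eq_intros\<close>)
  then have "r p \<le> 0"
    using seg[OF zero] by (intro tendsto_upperbound[where F = "at_right (0::real)"])
      (auto elim!: eventually_mono)
  moreover have "\<not> r p < 0"
    using U(2,4) Np in_iff_N_less by (metis (mono_tags, lifting) IntD1 less_irrefl mem_Collect_eq)
  ultimately show rp: "r p = 0" by simp
  have le: "D (b - p) \<le> 0" if b: "b \<in> A" for b
  proof (rule ccontr)
    assume neg: "\<not> D (b - p) \<le> 0"
    have "((\<lambda>s. r (p + s *\<^sub>R (b - p))) has_derivative (\<lambda>s. D (s *\<^sub>R (b - p)))) (at 0)"
      by (rule has_derivative_compose[where g = r])
        (use r in \<open>auto intro!: derivative_eq_intros\<close>)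
    then have "((\<lambda>s. r (p + s *\<^sub>R (b - p))) has_real_derivative D (b - p)) (at 0)"
      by (simp add: has_field_derivative_def D.scaleR mult_commute_abs)
    then have "\<exists>d>0. \<forall>h>0. h < d \<longrightarrow> r p < r (p + h *\<^sub>R (b - p))"
      using DERIV_pos_inc_right[of "\<lambda>s. r (p + s *\<^sub>R (b - p))" "D (b - p)" 0] neg by simp
    then obtain d where d: "0 < d" "\<And>h. 0 < h \<Longrightarrow> h < d \<Longrightarrow> r p < r (p + h *\<^sub>R (b - p))"
      by blast
    have "\<forall>\<^sub>F s in at_right 0. 0 < s \<and> s < d"
      using eventually_at_right_real[OF d(1)] by simp
    with seg[OF b] have "\<forall>\<^sub>F s::real in at_right 0. False"
      by eventually_elim (use d rp in force)
    then show False by simp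
  qed
  obtain v where v: "0 < D v"
  proof -
    obtain w where "D w \<noteq> 0" using r(2) by blast
    then show ?thesis
      using that[of w] that[of "- w"] by (cases "0 < D w") (auto simp: linear_neg[OF has_derivative_linear[OF r(1)]])
  qed
  have "((\<lambda>s. s *\<^sub>R v) \<longlongrightarrow> 0 *\<^sub>R v) (at_right 0)"
    by (intro tendsto_intros)
  then have "\<forall>\<^sub>F s in at_right 0. s *\<^sub>R v \<in> A"
    using op zero by (intro topological_tendstoD) auto
  moreover have "\<forall>\<^sub>F s::real in at_right 0. 0 < s"
    by (rule eventually_at_right_less)
  ultimately have "\<forall>\<^sub>F s in at_right 0. 0 < s \<and> s *\<^sub>R v \<in> A"
    by eventually_elim simp
  from eventually_happens'[OF trivial_limit_at_right_real this]
  obtain s where "0 < s" "s *\<^sub>R v \<in> A"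
    by blast
  then show "0 < D p"
    using le[of "s *\<^sub>R v"] v by (simp add: D.diff D.scaleR) (smt (verit) mult_pos_pos)
qed

lemma N_vimage_open:
  assumes "open U"
  shows "open {x. x \<noteq> 0 \<and> x /\<^sub>R N x \<in> U}"
proof -
  have "continuous_on (- {0}) (\<lambda>x. x /\<^sub>R N x)"
    using N_pos by (intro continuous_intros N_continuous_on) force
  then have "open (- {0} \<inter> (\<lambda>x. x /\<^sub>R N x) -` U)"
    using assms by (intro continuous_open_preimage) auto
  moreover have "- {0} \<inter> (\<lambda>x. x /\<^sub>R N x) -` U = {x. x \<noteq> 0 \<and> x /\<^sub>R N x \<in> U}"
    by auto
  ultimately show ?thesis by simp
qed

lemma N_normalize:
  "x \<noteq> 0 \<Longrightarrow> N (x /\<^sub>R N x) = 1"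
  using N_pos[of x] by (simp add: N_scale)

end

section \<open>Regularity of the gauge and a convex defining function\<close>

lemma Ck_boundary_shift:
  assumes "Ck_boundary k \<Omega>"
  shows "Ck_boundary k ((\<lambda>x. c + x) -` \<Omega>)"
proof -
  have "(\<lambda>x. c + x) -` \<Omega> = (\<lambda>x. - c + x) ` \<Omega>"
    by (force simp: image_iff)
  then have fr: "frontier ((\<lambda>x. c + x) -` \<Omega>) = (\<lambda>x. c + x) -` frontier \<Omega>"
    using frontier_translation[of "- c" \<Omega>] by (force simp: image_iff)
  show ?thesis
    unfolding Ck_boundary_def fr
  proof
    fix p assume "p \<in> (\<lambda>x. c + x) -` frontier \<Omega>"
    then obtain U r where U: "open U" "c + p \<in> U" "higher_differentiable_on U r k"
      "\<Omega> \<inter> U = {z\<in>U. r z < 0}"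
      "\<forall>z\<in>U \<inter> frontier \<Omega>. frechet_derivative r (at z) \<noteq> (\<lambda>_. 0)"
      using assms by (auto simp: Ck_boundary_def)
    let ?U = "(\<lambda>x. c + x) -` U"
    have "open ?U"
      using U(1) by (rule open_vimage) (intro continuous_intros)
    moreover have "(\<lambda>x. c + x) -` \<Omega> \<inter> ?U = {z \<in> ?U. r (c + z) < 0}"
      using U(4) by blast
    ultimately show "\<exists>U r. open U \<and> p \<in> U \<and> higher_differentiable_on U r k \<and>
        (\<lambda>x. c + x) -` \<Omega> \<inter> U = {z\<in>U. r z < 0} \<and>
        (\<forall>z\<in>U \<inter> (\<lambda>x. c + x) -` frontier \<Omega>. frechet_derivative r (at z) \<noteq> (\<lambda>_. 0))"
      using U higher_differentiable_on_shift[OF U(3), of c]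
      by (intro exI[of _ ?U] exI[of _ "\<lambda>z. r (c + z)"]) (auto simp: frechet_derivative_shift)
  qed
qed

text \<open>A bootstrap: the formula of \<open>N_has_derivative\<close> expresses the derivative of
  \<open>N\<close> through \<open>N\<close> itself and the first derivatives of \<open>r\<close> at
  the radial projection. Hence class \<open>j\<close> of \<open>N\<close> gives class
  \<open>j\<close> of its derivative; transversality keeps the denominator away from zero.\<close>

lemma gauge_higher_differentiable_local:
  fixes A :: "'a::euclidean_space set"
  assumes "convex_body A"
    and U: "open U" "A \<inter> U = {z \<in> U. r z < 0}"
    and r: "higher_differentiable_on U r (Suc m)"
    and Dr: "\<And>z. z \<in> U \<inter> frontier A \<Longrightarrow> frechet_derivative r (at z) \<noteq> (\<lambda>_. 0)"
    and j: "j \<le> Suc m"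
  shows "higher_differentiable_on {x. x \<noteq> 0 \<and> x /\<^sub>R gauge_fun A x \<in> U} (gauge_fun A) j"
  using j
proof (induction j)
  case 0
  interpret convex_body A by fact
  show ?case by (simp add: N_continuous_on)
next
  case (Suc j)
  interpret convex_body A by fact
  let ?S = "{x. x \<noteq> 0 \<and> x /\<^sub>R N x \<in> U}" and ?P = "\<lambda>x. x /\<^sub>R N x"
  let ?D = "\<lambda>x. frechet_derivative r (at (?P x))"
  have S: "open ?S" using U(1) by (rule N_vimage_open)
  have rD: "(r has_derivative ?D x) (at (?P x))" if "x \<in> ?S" for x
    using higher_differentiable_on_has_derivative[OF r] that by blast
  have r0: "r (?P x) = 0" "0 < ?D x (?P x)" if "x \<in> ?S" for x
  proof -
    have "?P x \<in> frontier A"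
      using that N_normalize by (simp add: frontier_eq)
    then show "r (?P x) = 0" "0 < ?D x (?P x)"
      using local_defining_function_frontier[OF U(1) _ _ U(2) rD[OF that] Dr] that by auto
  qed
  have der: "(N has_derivative (\<lambda>v. ?D x v / ?D x (?P x))) (at x)" if "x \<in> ?S" for x
  proof (rule N_has_derivative)
    have "\<forall>\<^sub>F y in at x. y \<in> ?S"
      using S that by (rule eventually_at_in_open')
    then show "\<forall>\<^sub>F y in at x. r (?P y) = 0"
      by eventually_elim (rule r0)
  qed (use that rD r0[OF that] in auto)
  have IH: "higher_differentiable_on ?S N j" using Suc by simp
  have invN: "higher_differentiable_on ?S (\<lambda>x. inverse (N x)) j"
    by (rule higher_differentiable_on_compose_real[OF S _ _ higher_differentiable_on_inverse IH])
      (use N_pos in \<open>force simp: open_Compl\<close>)+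
  have lin: "higher_differentiable_on ?S (\<lambda>x. x \<bullet> b) j" for b
    by (rule higher_differentiable_on_bounded_linear[OF S bounded_linear_inner_left])
  have P: "higher_differentiable_on ?S (\<lambda>x. ?P x \<bullet> b) j" for b
    using higher_differentiable_on_mult[OF S invN lin] by simp
  \<comment> \<open>The derivatives of \<open>r\<close> are only of class \<open>m\<close>, so the
    bootstrap runs exactly as far as \<open>Suc j \<le> Suc m\<close>.\<close>
  have "higher_differentiable_on U (\<lambda>z. frechet_derivative r (at z) v) j" for v
    by (rule higher_differentiable_on_le[of _ _ m]) (use r Suc.prems in auto)
  then have D: "higher_differentiable_on ?S (\<lambda>x. ?D x v) j" for v
    by (rule higher_differentiable_on_compose[OF S U(1), rotated]) (use P in auto)
  \<comment> \<open>Here \<open>x\<close> enters both the base point and the argument of the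
    derivative; expanding the argument in the basis separates the two dependencies.\<close>
  have DP: "?D x (?P x) = (\<Sum>b\<in>Basis. (?P x \<bullet> b) * ?D x b)" if "x \<in> ?S" for x
  proof -
    have "linear (?D x)"
      using rD[OF that] has_derivative_linear by blast
    then have "?D x (\<Sum>b\<in>Basis. (?P x \<bullet> b) *\<^sub>R b) = (\<Sum>b\<in>Basis. (?P x \<bullet> b) * ?D x b)"
      by (simp only: linear_sum linear_scale real_scaleR_def)
    then show ?thesis
      by (simp only: euclidean_representation)
  qed
  have "higher_differentiable_on ?S (\<lambda>x. \<Sum>b\<in>Basis. (?P x \<bullet> b) * ?D x b) j"
    by (intro higher_differentiable_on_sum higher_differentiable_on_mult S P D)
  then have DP': "higher_differentiable_on ?S (\<lambda>x. ?D x (?P x)) j"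
    by (rule higher_differentiable_on_cong[OF S]) (simp only: DP)
  have "higher_differentiable_on ?S (\<lambda>x. inverse (?D x (?P x))) j"
    by (rule higher_differentiable_on_compose_real[OF S _ _ higher_differentiable_on_inverse DP'])
      (use r0(2) in \<open>force simp: open_Compl\<close>)+
  then have "higher_differentiable_on ?S (\<lambda>x. ?D x v / ?D x (?P x)) j" for v
    unfolding divide_inverse by (intro higher_differentiable_on_mult S D)
  with der show ?case
    by (rule higher_differentiable_on_derivI[OF S])
qed

text \<open>Every non-zero point projects radially to the boundary, so the cones over the boundary
  charts cover the complement of the origin.\<close>

lemma gauge_higher_differentiable:
  fixes A :: "(complex^'n) set"
  assumes "convex_body A" "Ck_boundary k A" "1 \<le> k"
  shows "higher_differentiable_on (- {0}) (gauge_fun A) k"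
proof (rule higher_differentiable_on_local)
  interpret convex_body A by fact
  fix x :: "complex^'n" assume "x \<in> - {0}"
  then have x: "x \<noteq> 0" by simp
  then have "x /\<^sub>R N x \<in> frontier A"
    using N_normalize by (simp add: frontier_eq)
  then obtain U r where U: "open U" "x /\<^sub>R N x \<in> U" "higher_differentiable_on U r k"
      "A \<inter> U = {z\<in>U. r z < 0}"
      "\<forall>z\<in>U \<inter> frontier A. frechet_derivative r (at z) \<noteq> (\<lambda>_. 0)"
    using assms(2) by (auto simp: Ck_boundary_def)
  obtain m where k: "k = Suc m" using assms(3) by (cases k) auto
  have "higher_differentiable_on {x. x \<noteq> 0 \<and> x /\<^sub>R N x \<in> U} N k"
    using U(3,5) unfolding k
    by (intro gauge_higher_differentiable_local[OF assms(1) U(1,4)]) auto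
  then show "\<exists>T. open T \<and> x \<in> T \<and> higher_differentiable_on T N k"
    using N_vimage_open[OF U(1)] x U(2) by (intro exI[of _ "{x. x \<noteq> 0 \<and> x /\<^sub>R N x \<in> U}"]) auto
qed

section \<open>From the gauge to a convex defining function on the whole space\<close>

lemma convex_on_power_nonneg: "convex_on {0::real..} (\<lambda>x. x ^ n)"
  by (cases "even n")
    (auto intro: convex_power_odd convex_on_subset[OF convex_power_even])

text \<open>The gauge is not differentiable at the origin; flattening it below level \<open>1/2\<close> with the \<open>C^k\<close>
  convex function \<open>max 0 t ^ (k + 1)\<close> removes this singularity.\<close>

lemma convex_defining_function_centred:
  fixes A :: "(complex^'n) set"
  assumes "convex_body A" "Ck_boundary k A" "1 \<le> k"
  shows "\<exists>f. convex_on UNIV f \<and> higher_differentiable_on UNIV f k \<and>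
    A = {z. f z < 0} \<and> closure A = {z. f z \<le> 0}"
proof -
  interpret convex_body A by fact
  \<comment> \<open>The subtracted constant puts the zero of \<open>\<phi>\<close> at gauge level 1,
    the boundary; the power \<open>Suc k\<close> makes the truncation of class
    \<open>k\<close>.\<close>
  define \<phi> where "\<phi> t = max 0 (t - 1/2) ^ Suc k - (1/2) ^ Suc k" for t :: real
  have \<phi>_1: "\<phi> 1 = 0"
    by (simp add: \<phi>_def)
  \<comment> \<open>Below level \<open>1/2\<close> the function is constant; strict growth above it
    suffices to locate the sublevel sets at level 1.\<close>
  have strict: "\<phi> s < \<phi> t" if "s < t" "1/2 < t" for s t
    using that power_strict_mono[of "max 0 (s - 1/2)" "max 0 (t - 1/2)" "Suc k"]
    by (simp add: \<phi>_def del: power_Suc)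
  have less: "\<phi> t < 0 \<longleftrightarrow> t < 1" and le: "\<phi> t \<le> 0 \<longleftrightarrow> t \<le> 1" for t
    using strict[of t 1] strict[of 1 t] \<phi>_1 by (cases t "1::real" rule: linorder_cases; simp)+
  have "convex_on UNIV (\<lambda>x. \<phi> (N x))"
  proof (rule convex_onI)
    fix t :: real and x y :: "complex^'n"
    assume t: "0 < t" "t < 1"
    define a b where "a = max 0 (N x - 1/2)" and "b = max 0 (N y - 1/2)"
    have "max 0 (N ((1 - t) *\<^sub>R x + t *\<^sub>R y) - 1/2) \<le> (1 - t) * a + t * b"
    proof -
      have "N ((1 - t) *\<^sub>R x + t *\<^sub>R y) \<le> (1 - t) * N x + t * N y"
        using t by (intro convex_onD[OF N_convex]) auto
      also have "\<dots> \<le> (1 - t) * (a + 1/2) + t * (b + 1/2)"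
        using t by (intro add_mono mult_left_mono) (auto simp: a_def b_def)
      also have "\<dots> = ((1 - t) * a + t * b) + 1/2"
        by (simp add: field_simps)
      finally have "N ((1 - t) *\<^sub>R x + t *\<^sub>R y) \<le> ((1 - t) * a + t * b) + 1/2" .
      moreover have "0 \<le> (1 - t) * a + t * b"
        using t by (simp add: a_def b_def)
      ultimately show ?thesis by simp
    qed
    then have "max 0 (N ((1 - t) *\<^sub>R x + t *\<^sub>R y) - 1/2) ^ Suc k \<le> ((1 - t) * a + t * b) ^ Suc k"
      by (rule power_mono) simp
    also have "\<dots> \<le> (1 - t) * a ^ Suc k + t * b ^ Suc k"
      using convex_onD[OF convex_on_power_nonneg, of t a b "Suc k"] t by (simp add: a_def b_def del: power_Suc)
    finally show "\<phi> (N ((1 - t) *\<^sub>R x + t *\<^sub>R y)) \<le> (1 - t) * \<phi> (N x) + t * \<phi> (N y)"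
      by (simp add: \<phi>_def a_def b_def algebra_simps del: power_Suc)
  qed simp
  moreover have "higher_differentiable_on UNIV (\<lambda>x. \<phi> (N x)) k"
  proof (rule higher_differentiable_on_local)
    fix x :: "complex^'n"
    show "\<exists>T. open T \<and> x \<in> T \<and> higher_differentiable_on T (\<lambda>x. \<phi> (N x)) k"
    proof (cases "x = 0")
      case True
      have "open {x. N x < 1/2}"
        by (intro open_Collect_less N_continuous_on continuous_intros)
      moreover have "higher_differentiable_on {x. N x < 1/2} (\<lambda>x. \<phi> (N x)) k"
        by (rule higher_differentiable_on_cong[OF calculation higher_differentiable_on_const[of _ "\<phi> 0"]])
          (simp add: \<phi>_def)
      ultimately show ?thesis
        using True by (intro exI[of _ "{x. N x < 1/2}"]) auto
    next
      case False
      have "higher_differentiable_on UNIV \<phi> k"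
      proof -
        have "higher_differentiable_on UNIV (\<lambda>t. max 0 (t - 1/2) ^ Suc k) k"
          using higher_differentiable_on_shift[OF higher_differentiable_on_max_0_power[of k "Suc k"], of "- (1/2)"]
          by (simp del: power_Suc)
        then show ?thesis
          unfolding \<phi>_def by (intro higher_differentiable_on_diff) auto
      qed
      then have "higher_differentiable_on (- {0}) (\<lambda>x. \<phi> (N x)) k"
        by (intro higher_differentiable_on_compose_real[OF _ _ _ _ gauge_higher_differentiable[OF assms]])
          (auto simp: open_Compl)
      then show ?thesis
        using False by (intro exI[of _ "- {0}"]) (auto simp: open_Compl)
    qed
  qed
  ultimately show ?thesis
    by (intro exI[of _ "\<lambda>x. \<phi> (N x)"]) (simp add: less le closure_eq flip: in_iff_N_less)
qed

lemma convex_on_shift: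
  "convex_on UNIV f \<Longrightarrow> convex_on UNIV (\<lambda>x. f (c + x))"
  for c :: "'a::real_vector"
  unfolding convex_on_def
proof (intro conjI allI ballI impI, simp)
  fix x y :: 'a and u v :: real
  assume f: "convex UNIV \<and> (\<forall>x\<in>UNIV. \<forall>y\<in>UNIV. \<forall>u\<ge>0. \<forall>v\<ge>0. u + v = 1 \<longrightarrow>
    f (u *\<^sub>R x + v *\<^sub>R y) \<le> u * f x + v * f y)" and uv: "0 \<le> u" "0 \<le> v" "u + v = 1"
  have "u *\<^sub>R (c + x) + v *\<^sub>R (c + y) = (u + v) *\<^sub>R c + (u *\<^sub>R x + v *\<^sub>R y)"
    by (simp add: algebra_simps)
  then show "f (c + (u *\<^sub>R x + v *\<^sub>R y)) \<le> u * f (c + x) + v * f (c + y)"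
    using f uv by (metis UNIV_I scaleR_one)
qed

lemma convex_defining_function:
  fixes \<Omega> :: "(complex^'n) set"
  assumes "open \<Omega>" "convex \<Omega>" "bounded \<Omega>" "\<Omega> \<noteq> {}" "Ck_boundary k \<Omega>" "1 \<le> k"
  obtains f where "convex_on UNIV f" "higher_differentiable_on UNIV f k"
    "\<Omega> = {z. f z < 0}" "closure \<Omega> = {z. f z \<le> 0}"
proof -
  obtain c where c: "c \<in> \<Omega>" using assms(4) by blast
  define A where "A = (\<lambda>x. c + x) -` \<Omega>"
  have A: "A = (\<lambda>x. - c + x) ` \<Omega>"
    by (force simp: A_def image_iff)
  have "convex_body A"
  proof
    show "open A" unfolding A by (rule open_translation[OF assms(1)])
    show "convex A" unfolding A by (rule convex_translation[OF assms(2)])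
    show "bounded A" unfolding A by (rule bounded_translation[OF assms(3)])
    show "0 \<in> A" using c by (simp add: A_def)
  qed
  moreover have "Ck_boundary k A"
    unfolding A_def using assms(5) by (rule Ck_boundary_shift)
  ultimately obtain f where f: "convex_on UNIV f" "higher_differentiable_on UNIV f k"
    "A = {z. f z < 0}" "closure A = {z. f z \<le> 0}"
    using convex_defining_function_centred assms(6) by blast
  have cl: "closure A = (\<lambda>x. - c + x) ` closure \<Omega>"
    unfolding A by (rule closure_translation)
  show ?thesis
  proof (rule that[of "\<lambda>z. f (- c + z)"])
    show "convex_on UNIV (\<lambda>z. f (- c + z))"
      using f(1) by (rule convex_on_shift)
    show "higher_differentiable_on UNIV (\<lambda>z. f (- c + z)) k"
      using higher_differentiable_on_shift[OF f(2), of "- c"] by simp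
    have "z \<in> \<Omega> \<longleftrightarrow> - c + z \<in> A" for z
      by (simp add: A_def)
    then show "\<Omega> = {z. f (- c + z) < 0}"
      using f(3) by blast
    have "z \<in> closure \<Omega> \<longleftrightarrow> - c + z \<in> closure A" for z
      unfolding cl by (auto simp: image_iff)
    then show "closure \<Omega> = {z. f (- c + z) \<le> 0}"
      using f(4) by blast
  qed
qed

section \<open>Defining functions realising a given exponent\<close>

text \<open>The slope of a convex function at \<open>p\<close> towards \<open>a\<close> is at most
  the secant slope \<open>f a - f p\<close>. This gives \<open>f\<close> a non-zero derivative on
  its zero level as soon as it is negative somewhere.\<close>

lemma convex_on_derivative_neg:
  assumes f: "convex_on UNIV f" and D: "(f has_derivative D) (at p)" and "f a < f p"
  shows "D (a - p) < 0"
proof (rule ccontr)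
  assume neg: "\<not> D (a - p) < 0"
  interpret D: bounded_linear D
    using D has_derivative_bounded_linear by blast
  have "((\<lambda>s. f (p + s *\<^sub>R (a - p))) has_derivative (\<lambda>s. D (s *\<^sub>R (a - p)))) (at 0)"
    by (rule has_derivative_compose[where g = f])
      (use D in \<open>auto intro!: derivative_eq_intros\<close>)
  then have "((\<lambda>s. f (p + s *\<^sub>R (a - p))) has_real_derivative D (a - p)) (at 0)"
    by (simp add: has_field_derivative_def D.scaleR mult_commute_abs)
  \<comment> \<open>Adding the reversed secant makes the derivative strictly positive, hence the sum
    increases just to the right of 0, whereas convexity keeps it at most \<open>f p\<close> on the
    segment.\<close>
  then have "((\<lambda>s. f (p + s *\<^sub>R (a - p)) + s * (f p - f a)) has_real_derivative D (a - p) + (f p - f a)) (at 0)"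
    by (auto intro!: derivative_eq_intros)
  then have "\<exists>d>0. \<forall>h>0. h < d \<longrightarrow> f p < f (p + h *\<^sub>R (a - p)) + h * (f p - f a)"
    using DERIV_pos_inc_right[of "\<lambda>s. f (p + s *\<^sub>R (a - p)) + s * (f p - f a)" "D (a - p) + (f p - f a)" 0]
      neg assms(3) by simp
  then obtain d where d: "0 < d" "\<And>h. 0 < h \<Longrightarrow> h < d \<Longrightarrow> f p < f (p + h *\<^sub>R (a - p)) + h * (f p - f a)"
    by blast
  define h where "h = min (d / 2) 1"
  have h: "0 < h" "h < d" "h \<le> 1" using d by (auto simp: h_def)
  have "f ((1 - h) *\<^sub>R p + h *\<^sub>R a) \<le> (1 - h) * f p + h * f a"
    using h by (intro convex_onD[OF f]) auto
  then show False
    using d(2)[OF h(1,2)] by (simp add: algebra_simps)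
qed

text \<open>Raising the weight to the power \<open>\<eta>\<close> turns its exponent
  \<open>(1 - \<eta>) / \<eta>\<close> into \<open>1 - \<eta>\<close>, the form required by
  \<open>strictly_plurisubharmonic_on_powr\<close>. On the ball the weight is positive and smooth
  for either sign of its exponent, so \<open>\<rho>\<close> keeps the sign and the regularity of
  \<open>f\<close>.\<close>

lemma exponent_realised:
  fixes \<Omega> :: "(complex^'n) set" and \<eta> :: real
  assumes \<Omega>: "open \<Omega>" "\<Omega> \<noteq> {}"
    and R: "closure \<Omega> \<subseteq> ball 0 R"
    and f: "convex_on UNIV f" "higher_differentiable_on UNIV f k" "1 \<le> k"
      "\<Omega> = {z. f z < 0}" "closure \<Omega> = {z. f z \<le> 0}"
    and \<eta>: "0 < \<eta>" "\<eta> \<noteq> 1"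
  defines "\<rho> \<equiv> \<lambda>z. f z * (R\<^sup>2 - (norm z)\<^sup>2) powr ((1 - \<eta>) / \<eta>)"
  shows "defining_function k \<Omega> (ball 0 R) \<rho>"
    and "\<eta> < 1 \<Longrightarrow> strictly_plurisubharmonic_on \<Omega> (\<lambda>z. - ((- \<rho> z) powr \<eta>))"
    and "1 < \<eta> \<Longrightarrow> strictly_plurisubharmonic_on (- closure \<Omega> \<inter> ball 0 R) (\<lambda>z. \<rho> z powr \<eta>)"
proof -
  let ?g = "\<lambda>z::complex^'n. R\<^sup>2 - (norm z)\<^sup>2"
  let ?G = "\<lambda>z. ?g z powr ((1 - \<eta>) / \<eta>)"
  have g_pos: "0 < ?g z" if "z \<in> ball 0 R" for z
    using that power_strict_mono[of "norm z" R 2] by auto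
  have "higher_differentiable_on (ball 0 R) ?g k"
  proof -
    have "higher_differentiable_on (ball 0 R) (\<lambda>z::complex^'n. \<Sum>b\<in>Basis. (z \<bullet> b) * (z \<bullet> b)) k"
      by (intro higher_differentiable_on_sum higher_differentiable_on_mult
          higher_differentiable_on_bounded_linear bounded_linear_inner_left) auto
    then have "higher_differentiable_on (ball 0 R) (\<lambda>z::complex^'n. (norm z)\<^sup>2) k"
      by (rule higher_differentiable_on_cong[OF open_ball])
        (simp add: power2_norm_eq_inner euclidean_inner[symmetric])
    then show ?thesis
      by (intro higher_differentiable_on_diff) auto
  qed
  then have G: "higher_differentiable_on (ball 0 R) ?G k"
    by (rule higher_differentiable_on_compose_real[OF _ _ _ higher_differentiable_on_powr, rotated -1])
      (use g_pos in auto)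
  have f': "higher_differentiable_on (ball 0 R) f k"
    by (rule higher_differentiable_on_subset[OF f(2)]) simp
  have \<rho>: "higher_differentiable_on (ball 0 R) \<rho> k"
    unfolding \<rho>_def by (rule higher_differentiable_on_mult[OF open_ball f' G])
  have dif: "h differentiable (at z)" if "higher_differentiable_on (ball 0 R) h k" "z \<in> ball 0 R"
    for h :: "complex^'n \<Rightarrow> real" and z
    using that f(3) by (cases k) auto
  have neg_iff: "\<rho> z < 0 \<longleftrightarrow> f z < 0" if "z \<in> ball 0 R" for z
    using g_pos[OF that] by (simp add: \<rho>_def mult_less_0_iff)
  \<comment> \<open>On the frontier \<open>f\<close> vanishes, so the product rule leaves only the
    derivative of \<open>f\<close> times the positive weight; the direction towards a point where
    \<open>f < 0\<close> shows that it is non-zero.\<close>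
  have "frechet_derivative \<rho> (at z) \<noteq> (\<lambda>_. 0)" if z: "z \<in> frontier \<Omega>" for z
  proof -
    have zR: "z \<in> ball 0 R" using z R by (auto simp: frontier_def)
    have fz: "f z = 0"
      using z f(4,5) \<Omega>(1) by (auto simp: frontier_def interior_open)
    obtain a where a: "f a < 0" using \<Omega>(2) f(4) by blast
    let ?Df = "frechet_derivative f (at z)" and ?DG = "frechet_derivative ?G (at z)"
    have Df: "(f has_derivative ?Df) (at z)"
      using dif[OF f' zR] by (simp add: frechet_derivative_works)
    have DG: "(?G has_derivative ?DG) (at z)"
      using dif[OF G zR] by (simp add: frechet_derivative_works)
    have "(\<rho> has_derivative (\<lambda>h. f z * ?DG h + ?Df h * ?G z)) (at z)"
      unfolding \<rho>_def by (rule has_derivative_mult[OF Df DG])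
    then have "frechet_derivative \<rho> (at z) = (\<lambda>h. f z * ?DG h + ?Df h * ?G z)"
      by (rule frechet_derivative_at[symmetric])
    then have "frechet_derivative \<rho> (at z) (a - z) = ?Df (a - z) * ?G z"
      by (simp add: fz)
    also have "\<dots> < 0"
      using convex_on_derivative_neg[OF f(1) Df, of a] a fz g_pos[OF zR] by (simp add: mult_neg_pos)
    finally show ?thesis by force
  qed
  then show "defining_function k \<Omega> (ball 0 R) \<rho>"
    using R \<rho> neg_iff f(4) closure_subset[of \<Omega>] by (fastforce simp: defining_function_def)
  have cont: "continuous_on S f" for S
    using higher_differentiable_on_imp_continuous_on[OF f(2)] continuous_on_subset by blast
  have powr_\<rho>: "(s * \<rho> z) powr \<eta> = (s * f z) powr \<eta> * ?g z powr (1 - \<eta>)"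
    if "z \<in> ball 0 R" "0 \<le> s * f z" for s z
  proof -
    have "(s * \<rho> z) powr \<eta> = ((s * f z) * ?G z) powr \<eta>"
      by (simp add: \<rho>_def mult.assoc)
    also have "\<dots> = (s * f z) powr \<eta> * ?g z powr (1 - \<eta>)"
      using that \<eta>(1) by (simp add: powr_mult powr_powr)
    finally show ?thesis .
  qed
  show "strictly_plurisubharmonic_on \<Omega> (\<lambda>z. - ((- \<rho> z) powr \<eta>))" if "\<eta> < 1"
  proof (rule strictly_plurisubharmonic_on_powr[OF \<eta> \<Omega>(1) _ f(1) cont])
    show "\<Omega> \<subseteq> ball 0 R" using R closure_subset by blast
    then show "- ((- \<rho> z) powr \<eta>)
        = sgn (\<eta> - 1) * ((sgn (\<eta> - 1) * f z) powr \<eta> * ?g z powr (1 - \<eta>))" if "z \<in> \<Omega>" for z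
      using powr_\<rho>[of z "-1"] that \<open>\<eta> < 1\<close> f(4) by auto
  qed (use that f(4) in auto)
  have "open (- closure \<Omega> \<inter> ball 0 R)"
    by (intro open_Int open_Compl) auto
  then show "strictly_plurisubharmonic_on (- closure \<Omega> \<inter> ball 0 R) (\<lambda>z. \<rho> z powr \<eta>)" if "1 < \<eta>"
  proof (rule strictly_plurisubharmonic_on_powr[OF \<eta> _ _ f(1) cont])
    show "\<rho> z powr \<eta> = sgn (\<eta> - 1) * ((sgn (\<eta> - 1) * f z) powr \<eta> * ?g z powr (1 - \<eta>))"
      if "z \<in> - closure \<Omega> \<inter> ball 0 R" for z
      using powr_\<rho>[of z 1] that \<open>1 < \<eta>\<close> f(5) by auto
  qed (use that f(5) in \<open>auto\<close>)
qed

section \<open>Computation of the two indices\<close>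

theorem corollary7p2:
  fixes \<Omega> :: "(complex^'n) set" and k :: nat
  assumes "k \<ge> 1"
    and "open \<Omega>" and "connected \<Omega>" and "\<Omega> \<noteq> {}"
    and "bounded \<Omega>"
    and "convex \<Omega>"
    and "Ck_boundary k \<Omega>"
  shows "DF_index k \<Omega> = 1 \<and> Steinness_index k \<Omega> = 1"
proof -
  obtain f where f: "convex_on UNIV f" "higher_differentiable_on UNIV f k"
    "\<Omega> = {z. f z < 0}" "closure \<Omega> = {z. f z \<le> 0}"
    by (rule convex_defining_function[OF assms(2,6,5,4,7,1)])
  obtain R where R: "closure \<Omega> \<subseteq> ball 0 R"
    using bounded_subset_ballD[OF bounded_closure[OF assms(5)], of 0] by blast
  note realised = exponent_realised[OF assms(2,4) R f(1,2) assms(1) f(3,4)]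
  have DF_lower: "ereal \<eta> \<le> DF_index k \<Omega>" if \<eta>: "0 < \<eta>" "\<eta> < 1" for \<eta>
  proof -
    obtain \<rho> where \<rho>: "defining_function k \<Omega> (ball 0 R) \<rho>" "\<eta> \<in> DF_exponents \<Omega> \<rho>"
      using realised(1,2)[of \<eta>] \<eta> by (auto simp: DF_exponents_def)
    then have "ereal \<eta> \<le> DF_index_of \<Omega> \<rho>"
      by (auto simp: DF_index_of_def intro: Sup_upper)
    also have "\<dots> \<le> DF_index k \<Omega>"
      unfolding DF_index_def using \<rho>(1) by (intro Sup_upper) blast
    finally show ?thesis .
  qed
  \<comment> \<open>All exponents lie below 1, and the default index 0 for an empty set does
    too.\<close>
  have DF_le: "DF_index k \<Omega> \<le> 1"
    unfolding DF_index_def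
    by (rule Sup_least) (auto simp: DF_index_of_def DF_exponents_def intro!: Sup_least)
  have DF_ge: "1 \<le> DF_index k \<Omega>"
  proof (rule dense_le)
    fix y :: ereal assume "y < 1"
    then obtain \<eta> where "y < ereal \<eta>" "ereal \<eta> < 1"
      using ereal_dense2 by blast
    then have "y \<le> ereal \<eta>"
      by simp
    \<comment> \<open>The number \<open>y\<close>, and with it \<open>\<eta>\<close>, may be
      negative; the maximum with \<open>1/2\<close> restores a positive exponent still below
      1.\<close>
    also have "ereal \<eta> \<le> ereal (max \<eta> (1/2))"
      by simp
    also have "\<dots> \<le> DF_index k \<Omega>"
      by (rule DF_lower) (use \<open>ereal \<eta> < 1\<close> in auto)
    finally show "y \<le> DF_index k \<Omega>" .
  qed
  have S_upper: "Steinness_index k \<Omega> \<le> ereal \<eta>" if \<eta>: "1 < \<eta>" for \<eta>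
  proof -
    obtain \<rho> where \<rho>: "defining_function k \<Omega> (ball 0 R) \<rho>"
      "strictly_plurisubharmonic_on (- closure \<Omega> \<inter> ball 0 R) (\<lambda>z. \<rho> z powr \<eta>)"
      using realised(1,3)[of \<eta>] \<eta> by auto
    have "frontier \<Omega> \<subseteq> ball 0 R"
      using R by (auto simp: frontier_def)
    \<comment> \<open>The ball serves both as the domain of \<open>\<rho>\<close> and as the
      neighbourhood \<open>U\<close> of the boundary.\<close>
    then have "\<eta> \<in> Stein_exponents \<Omega> (ball 0 R) \<rho>"
      using \<rho>(2) \<eta> by (auto simp: Stein_exponents_def intro!: exI[of _ "ball 0 R"])
    then have "Steinness_index_of \<Omega> (ball 0 R) \<rho> \<le> ereal \<eta>"
      by (auto simp: Steinness_index_of_def intro: Inf_lower)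
    moreover have "Steinness_index k \<Omega> \<le> Steinness_index_of \<Omega> (ball 0 R) \<rho>"
      unfolding Steinness_index_def using \<rho>(1) by (intro Inf_lower) blast
    ultimately show ?thesis by (rule order_trans[rotated])
  qed
  \<comment> \<open>All exponents exceed 1, and so does the default value
    \<open>\<infinity>\<close>.\<close>
  have S_ge: "1 \<le> Steinness_index k \<Omega>"
    unfolding Steinness_index_def
    by (rule Inf_greatest) (auto simp: Steinness_index_of_def Stein_exponents_def intro!: Inf_greatest)
  have S_le: "Steinness_index k \<Omega> \<le> 1"
  proof (rule dense_ge)
    fix y :: ereal assume "1 < y"
    then obtain \<eta> where "1 < ereal \<eta>" "ereal \<eta> < y"
      using ereal_dense2 by blast
    then show "Steinness_index k \<Omega> \<le> y"
      using S_upper[of \<eta>] by (simp add: order_trans)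
  qed
  show ?thesis
    using antisym[OF DF_le DF_ge] antisym[OF S_le S_ge] by blast
qed

end
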